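(* There is a deterministic algorithm running in space $O(s+\log n)$ that, given an explicit $\varepsilon$-hitting set generator $H:\{0,1\}^s\to\{0,1\}^n$ for ordered branching programs of length $n$ and width $w^2$, oracle access to an ordered branching program $B$ of width $w$ and length $n$, and estimates $\{\tilde p_{x,i}\}_{x\in\{0,1\}^s,\,0\le i\le n}$, either outputs a value or rejects. Moreover: (1) if for every $x\in\{0,1\}^s$ and every $i<n$ we have $|p_{v\to}-\tilde p_{x,i}|\le 2\varepsilon$ where $v=B[v_0,H(x)_{1..i}]$, and $\tilde p_{x,n}=B(H(x))$, then the algorithm outputs a value; (2) if the algorithm outputs $\delta$, then $|\mathbb{E}[B]-\delta|\le 6\varepsilon n$.
   Context: An ordered branching program (OBP) $B$ of length $n$ and width $w$ is a directed acyclic graph with layers $V_0,\ldots,V_n$, $|V_i|\le w$, a single start state $v_0\in V_0$, two outgoing edges labeled $0$ and $1$ from each state of $V_i$ ($i<n$) into $V_{i+1}$, and labels in $\{0,1\}$ on $V_n$. For $v\in V_i$ and $\sigma\in\{0,1\}^k$, $B[v,\sigma]$ is the state in $V_{i+k}$ reached from $v$ following the edges labeled by $\sigma$; $B(x)$ is the label of $B[v_0,x]$ and $\mathbb{E}[B]=\Pr_{x\text{ uniform}}[B(x)=1]$. For $v\in V_i$, $p_{v\to}=\Pr_{r\in\{0,1\}^{n-i}\text{ uniform}}[B[v,r]\text{ has label }1]$. An $\varepsilon$-hitting set generator for a class $\mathcal{F}$ of functions $\{0,1\}^n\to\{0,1\}$ is a function $H:\{0,1\}^s\to\{0,1\}^n$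 such that every $f\in\mathcal{F}$ with $\mathbb{E}[f]\ge\varepsilon$ satisfies $f(H(y))=1$ for some $y$; it is explicit if $H(y)$ is computable in space $O(s)$ given $1^n$ and $y$. Oracle access to $B$ means the ability to query $B(z)$ for any $z\in\{0,1\}^n$. $H(x)_{1..i}$ denotes the first $i$ bits of $H(x)$.
   Formalization: ε and the estimates are taken to be rational numbers given to the algorithm in binary, with bit length at most an arbitrary fixed polynomial in 2^s·(n+2); the constant in O(s+log n) depends on that polynomial's exponent and on the generator's space constant. *)

theory Defs
  imports "HOL-Probability.Probability" "HOL-Library.Log_Nat"
begin

section \<open>Ordered branching programs and hitting set generators\<close>

definition cube :: "nat \<Rightarrow> bool list set" where
  "cube n = {x. length x = n}"

definition uniform_prob :: "nat \<Rightarrow> (bool list \<Rightarrow> bool) \<Rightarrow> real" where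
  "uniform_prob n f = measure_pmf.prob (pmf_of_set (cube n)) {x. f x}"

text \<open>States are natural numbers. This is no restriction, since the layers are finite, and it
  gives the class of all programs of a given length and width as a set.\<close>

record obp =
  layer :: "nat \<Rightarrow> nat set"
  start :: nat
  edge :: "nat \<Rightarrow> bool \<Rightarrow> nat"
  label :: "nat \<Rightarrow> bool"

definition is_obp :: "nat \<Rightarrow> nat \<Rightarrow> obp \<Rightarrow> bool" where
  "is_obp n w B \<longleftrightarrow>
     (\<forall>i\<le>n. finite (layer B i) \<and> card (layer B i) \<le> w) \<and>
     (\<forall>i\<le>n. \<forall>j\<le>n. i \<noteq> j \<longrightarrow> layer B i \<inter> layer B j = {}) \<and>
     start B \<in> layer B 0 \<and>
     (\<forall>i<n. \<forall>v\<in>layer B i. \<forall>b. edge B v b \<in> layer B (Suc i))"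

definition walk :: "obp \<Rightarrow> nat \<Rightarrow> bool list \<Rightarrow> nat" where
  "walk B v \<sigma> = foldl (edge B) v \<sigma>"

definition obp_eval :: "obp \<Rightarrow> bool list \<Rightarrow> bool" where
  "obp_eval B x = label B (walk B (start B) x)"

text \<open>For a state \<open>v\<close> in layer \<open>i\<close> of a program of length \<open>n\<close>, the number written
  \<open>p_{v\<rightarrow>}\<close> is \<open>accept_prob B (n - i) v\<close>.\<close>

definition accept_prob :: "obp \<Rightarrow> nat \<Rightarrow> nat \<Rightarrow> real" where
  "accept_prob B k v = uniform_prob k (\<lambda>r. label B (walk B v r))"

definition obp_functions :: "nat \<Rightarrow> nat \<Rightarrow> (bool list \<Rightarrow> bool) set" where
  "obp_functions n w = {obp_eval B | B. is_obp n w B}"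

definition hitting_set_generator ::
  "real \<Rightarrow> nat \<Rightarrow> nat \<Rightarrow> (bool list \<Rightarrow> bool) set \<Rightarrow> (bool list \<Rightarrow> bool list) \<Rightarrow> bool" where
  "hitting_set_generator \<epsilon> n s F H \<longleftrightarrow>
     (\<forall>y\<in>cube s. H y \<in> cube n) \<and>
     (\<forall>f\<in>F. uniform_prob n f \<ge> \<epsilon> \<longrightarrow> (\<exists>y\<in>cube s. f (H y)))"


section \<open>Space-bounded computation\<close>

text \<open>
  The machine model is a while language over finitely many registers holding natural numbers.
  The space of a configuration is the total number of binary digits of all registers. Up to a
  constant factor this is Turing machine work space: a work tape is a pair of numbers (two
  stacks), and conversely every operation below can be carried out in space linear in the digits
  of its operands. An expression occurring in a program has constant size, so its intermediate
  results are longer than the registers only by a constant factor.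

  Besides its registers a machine has

  \<^item> a read-only input tape, accessed by position (the position is computed from registers
    and so is paid for);
  \<^item> a write-only query tape, which is emptied by each query; as usual for queries longer
    than the work space, it is not charged;
  \<^item> a write-only output tape, not charged;
  \<^item> a subroutine, called on a number and returning one chosen bit of its output. A call
    is charged the space of the caller, the space of the run of the subroutine, and a counter
    for the position of the output bit.
\<close>

datatype expr =
    Num nat
  | Reg nat
  | Plus expr expr
  | Minus expr expr
  | Times expr expr
  | Div expr expr
  | Mod expr expr
  | Less expr expr

datatype com =
    Skip
  | Assign nat expr
  | Seq com com
  | If expr com com
  | While expr com
  | ReadInput nat expr     \<comment> \<open>target register, position\<close>
  | CallBit nat expr expr  \<comment> \<open>target register, argument, position in the output\<close>
  | PutQuery expr
  | AskQuery nat
  | PutOutput expr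

record state =
  regs :: "nat \<Rightarrow> nat"
  qtape :: "bool list"
  outtape :: "bool list"

text \<open>In \<open>sub_runs E y out m\<close> the subroutine, called on \<open>y\<close>, produces the output \<open>out\<close> in
  space \<open>m\<close>.\<close>

record env =
  in_tape :: "bool list"
  answer :: "bool list \<Rightarrow> bool"
  sub_runs :: "nat \<Rightarrow> bool list \<Rightarrow> nat \<Rightarrow> bool"

fun expr_val :: "(nat \<Rightarrow> nat) \<Rightarrow> expr \<Rightarrow> nat" where
  "expr_val \<rho> (Num k) = k"
| "expr_val \<rho> (Reg r) = \<rho> r"
| "expr_val \<rho> (Plus a b) = expr_val \<rho> a + expr_val \<rho> b"
| "expr_val \<rho> (Minus a b) = expr_val \<rho> a - expr_val \<rho> b"
| "expr_val \<rho> (Times a b) = expr_val \<rho> a * expr_val \<rho> b"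
| "expr_val \<rho> (Div a b) = expr_val \<rho> a div expr_val \<rho> b"
| "expr_val \<rho> (Mod a b) = expr_val \<rho> a mod expr_val \<rho> b"
| "expr_val \<rho> (Less a b) = (if expr_val \<rho> a < expr_val \<rho> b then 1 else 0)"

abbreviation val :: "state \<Rightarrow> expr \<Rightarrow> nat" where
  "val \<sigma> e \<equiv> expr_val (regs \<sigma>) e"

text \<open>\<open>floorlog 2 a\<close> is the number of binary digits of \<open>a\<close> (and \<open>0\<close> for \<open>a = 0\<close>). In every
  configuration reachable from an initial one only finitely many registers are nonzero.\<close>

definition space_of :: "state \<Rightarrow> nat" where
  "space_of \<sigma> = (\<Sum>r | regs \<sigma> r \<noteq> 0. floorlog 2 (regs \<sigma> r))"

definition set_reg :: "nat \<Rightarrow> nat \<Rightarrow> state \<Rightarrow> state" where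
  "set_reg r a \<sigma> = \<sigma>\<lparr>regs := (regs \<sigma>)(r := a)\<rparr>"

definition put_query :: "bool \<Rightarrow> state \<Rightarrow> state" where
  "put_query b \<sigma> = \<sigma>\<lparr>qtape := qtape \<sigma> @ [b]\<rparr>"

definition put_output :: "bool \<Rightarrow> state \<Rightarrow> state" where
  "put_output b \<sigma> = \<sigma>\<lparr>outtape := outtape \<sigma> @ [b]\<rparr>"

definition input_bit :: "bool list \<Rightarrow> nat \<Rightarrow> bool" where
  "input_bit xs j \<longleftrightarrow> j < length xs \<and> xs ! j"

text \<open>\<open>exec E c \<sigma> \<tau> m\<close>: started in \<open>\<sigma>\<close>, the command \<open>c\<close> halts in \<open>\<tau>\<close>, and \<open>m\<close> is the maximal
  space of the configurations passed.\<close>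

inductive exec :: "env \<Rightarrow> com \<Rightarrow> state \<Rightarrow> state \<Rightarrow> nat \<Rightarrow> bool" for E :: env where
  Skip: "exec E Skip \<sigma> \<sigma> (space_of \<sigma>)"
| Assign: "\<tau> = set_reg r (val \<sigma> e) \<sigma> \<Longrightarrow>
    exec E (Assign r e) \<sigma> \<tau> (max (space_of \<sigma>) (space_of \<tau>))"
| Seq: "exec E c1 \<sigma> \<rho> m1 \<Longrightarrow> exec E c2 \<rho> \<tau> m2 \<Longrightarrow> exec E (Seq c1 c2) \<sigma> \<tau> (max m1 m2)"
| IfTrue: "val \<sigma> e \<noteq> 0 \<Longrightarrow> exec E c1 \<sigma> \<tau> m \<Longrightarrow> exec E (If e c1 c2) \<sigma> \<tau> m"
| IfFalse: "val \<sigma> e = 0 \<Longrightarrow> exec E c2 \<sigma> \<tau> m \<Longrightarrow> exec E (If e c1 c2) \<sigma> \<tau> m"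
| WhileFalse: "val \<sigma> e = 0 \<Longrightarrow> exec E (While e c) \<sigma> \<sigma> (space_of \<sigma>)"
| WhileTrue: "val \<sigma> e \<noteq> 0 \<Longrightarrow> exec E c \<sigma> \<rho> m1 \<Longrightarrow> exec E (While e c) \<rho> \<tau> m2 \<Longrightarrow>
    exec E (While e c) \<sigma> \<tau> (max m1 m2)"
| ReadInput: "\<tau> = set_reg r (of_bool (input_bit (in_tape E) (val \<sigma> e))) \<sigma> \<Longrightarrow>
    exec E (ReadInput r e) \<sigma> \<tau> (max (space_of \<sigma>) (space_of \<tau>))"
| CallBit: "sub_runs E (val \<sigma> a) xs m \<Longrightarrow> val \<sigma> e < length xs \<Longrightarrow>
    \<tau> = set_reg r (of_bool (xs ! val \<sigma> e)) \<sigma> \<Longrightarrow>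
    exec E (CallBit r a e) \<sigma> \<tau>
      (max (space_of \<sigma> + m + floorlog 2 (val \<sigma> e)) (space_of \<tau>))"
| PutQuery: "exec E (PutQuery e) \<sigma> (put_query (val \<sigma> e \<noteq> 0) \<sigma>) (space_of \<sigma>)"
| AskQuery: "\<tau> = (set_reg r (of_bool (answer E (qtape \<sigma>))) \<sigma>)\<lparr>qtape := []\<rparr> \<Longrightarrow>
    exec E (AskQuery r) \<sigma> \<tau> (max (space_of \<sigma>) (space_of \<tau>))"
| PutOutput: "exec E (PutOutput e) \<sigma> (put_output (val \<sigma> e \<noteq> 0) \<sigma>) (space_of \<sigma>)"

text \<open>Programs are deterministic, both in their result and in the space they use.\<close>

inductive_cases exec_elims:
  "exec E Skip \<sigma> \<tau> m" "exec E (Assign r e) \<sigma> \<tau> m" "exec E (Seq c d) \<sigma> \<tau> m"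
  "exec E (If e c d) \<sigma> \<tau> m" "exec E (ReadInput r e) \<sigma> \<tau> m"
  "exec E (CallBit r a e) \<sigma> \<tau> m" "exec E (PutQuery e) \<sigma> \<tau> m" "exec E (AskQuery r) \<sigma> \<tau> m"
  "exec E (PutOutput e) \<sigma> \<tau> m"

inductive_cases exec_WhileE: "exec E (While e c) \<sigma> \<tau> m"

lemma exec_deterministic:
  assumes "\<And>y xs m xs' m'. sub_runs E y xs m \<Longrightarrow> sub_runs E y xs' m' \<Longrightarrow> xs = xs' \<and> m = m'"
  shows "exec E c \<sigma> \<tau> m \<Longrightarrow> exec E c \<sigma> \<tau>' m' \<Longrightarrow> \<tau> = \<tau>' \<and> m = m'"
proof (induction arbitrary: \<tau>' m' rule: exec.induct)
  case (Seq c1 \<sigma> \<rho> m1 c2 \<tau> m2)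
  from Seq.prems obtain \<rho>' m1' m2' where
    "exec E c1 \<sigma> \<rho>' m1'" "exec E c2 \<rho>' \<tau>' m2'" "m' = max m1' m2'"
    by (rule exec_elims(3))
  with Seq.IH show ?case by metis
next
  case (IfTrue \<sigma> e c1 \<tau> m c2)
  from IfTrue.prems have "exec E c1 \<sigma> \<tau>' m'"
    by (rule exec_elims(4)) (use IfTrue.hyps in simp_all)
  with IfTrue.IH show ?case by blast
next
  case (IfFalse \<sigma> e c2 \<tau> m c1)
  from IfFalse.prems have "exec E c2 \<sigma> \<tau>' m'"
    by (rule exec_elims(4)) (use IfFalse.hyps in simp_all)
  with IfFalse.IH show ?case by blast
next
  case (WhileFalse \<sigma> e c)
  from WhileFalse.prems show ?case
    by (rule exec_WhileE) (use WhileFalse.hyps in simp_all)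
next
  case (WhileTrue \<sigma> e c \<rho> m1 \<tau> m2)
  from WhileTrue.prems obtain \<rho>' m1' m2' where
    "exec E c \<sigma> \<rho>' m1'" "exec E (While e c) \<rho>' \<tau>' m2'" "m' = max m1' m2'"
    by (rule exec_WhileE) (use WhileTrue.hyps in simp_all)
  with WhileTrue.IH show ?case by metis
next
  case (CallBit \<sigma> a xs m e \<tau> r)
  from CallBit.prems obtain xs' k where
    "sub_runs E (val \<sigma> a) xs' k"
    "\<tau>' = set_reg r (of_bool (xs' ! val \<sigma> e)) \<sigma>"
    "m' = max (space_of \<sigma> + k + floorlog 2 (val \<sigma> e))
      (space_of (set_reg r (of_bool (xs' ! val \<sigma> e)) \<sigma>))"
    by (rule exec_elims(6))
  with CallBit.hyps assms show ?case by metis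
qed (erule exec_elims; simp)+

text \<open>Little-endian binary notation with \<open>l\<close> digits. For \<open>X < 2 ^ s\<close> the strings
  \<open>digits s X\<close> are the elements of \<open>cube s\<close>, each exactly once.\<close>

definition digits :: "nat \<Rightarrow> nat \<Rightarrow> bool list" where
  "digits l X = map (bit X) [0..<l]"

definition init :: "nat \<Rightarrow> nat \<Rightarrow> nat \<Rightarrow> state" where
  "init a b c = \<lparr>regs = (\<lambda>_. 0)(0 := a, 1 := b, 2 := c), qtape = [], outtape = []\<rparr>"

text \<open>A generator program runs on its own: no input tape, no queries, no subroutine. It receives
  \<open>n\<close>, the seed length \<open>s\<close> and the seed, and writes the generated string on the output tape.\<close>

definition closed_env :: env where
  "closed_env = \<lparr>in_tape = [], answer = (\<lambda>_. False), sub_runs = (\<lambda>_ _ _. False)\<rparr>"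

definition generator_runs :: "com \<Rightarrow> nat \<Rightarrow> nat \<Rightarrow> nat \<Rightarrow> bool list \<Rightarrow> nat \<Rightarrow> bool" where
  "generator_runs G n s X xs m \<longleftrightarrow>
     (\<exists>\<tau>. exec closed_env G (init n s X) \<tau> m \<and> outtape \<tau> = xs)"

text \<open>Explicitness, with program \<open>G\<close> and constant \<open>c\<close>. Space bounds are understood to be at
  least logarithmic in the input length, here \<open>n + s\<close> for the input \<open>(1^n, y)\<close>; hence the
  summand \<open>log n\<close>, which only makes the requirement on \<open>H\<close> weaker. The argument \<open>n + 2\<close> keeps the
  bound positive for all \<open>n\<close>.\<close>

definition explicit_generator ::
  "real \<Rightarrow> com \<Rightarrow> nat \<Rightarrow> nat \<Rightarrow> (bool list \<Rightarrow> bool list) \<Rightarrow> bool" where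
  "explicit_generator c G n s H \<longleftrightarrow>
     (\<forall>X<2^s. \<exists>m. generator_runs G n s X (H (digits s X)) m \<and>
        real m \<le> c * (real s + log 2 (real (n + 2))))"


section \<open>Input and output of the algorithm\<close>

text \<open>A rational number in lowest terms, written as a sign bit, the numerator and the (positive)
  denominator, the latter two with \<open>l\<close> digits each. The notation is faithful for the numbers
  with \<open>fits l q\<close>.\<close>

definition rat_digits :: "nat \<Rightarrow> rat \<Rightarrow> bool list" where
  "rat_digits l q = (case quotient_of q of (a, d) \<Rightarrow>
     [a < 0] @ digits l (nat \<bar>a\<bar>) @ digits l (nat d))"

definition fits :: "nat \<Rightarrow> rat \<Rightarrow> bool" where
  "fits l q = (case quotient_of q of (a, d) \<Rightarrow> nat \<bar>a\<bar> < 2 ^ l \<and> nat d < 2 ^ l)"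

definition input_tape ::
  "nat \<Rightarrow> nat \<Rightarrow> nat \<Rightarrow> rat \<Rightarrow> (bool list \<Rightarrow> nat \<Rightarrow> rat) \<Rightarrow> bool list" where
  "input_tape n s l \<epsilon> p = rat_digits l \<epsilon> @
     concat (map (\<lambda>X. concat (map (\<lambda>i. rat_digits l (p (digits s X) i)) [0..<Suc n])) [0..<2^s])"

text \<open>The environment of the algorithm: input tape with \<open>\<epsilon>\<close> and the estimates, queries to
  \<open>B\<close> on strings of length \<open>n\<close> (other queries return no information), and the program of the
  generator as subroutine.\<close>

definition alg_env ::
  "nat \<Rightarrow> nat \<Rightarrow> nat \<Rightarrow> rat \<Rightarrow> (bool list \<Rightarrow> nat \<Rightarrow> rat) \<Rightarrow> obp \<Rightarrow> com \<Rightarrow> env" where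
  "alg_env n s l \<epsilon> p B G =
     \<lparr>in_tape = input_tape n s l \<epsilon> p,
      answer = (\<lambda>z. z \<in> cube n \<and> obp_eval B z),
      sub_runs = generator_runs G n s\<rparr>"

text \<open>\<open>None\<close> is rejection, signalled by an empty output tape; \<open>Some \<delta>\<close> is the output \<open>\<delta>\<close>.\<close>

definition has_result :: "nat \<Rightarrow> state \<Rightarrow> rat option \<Rightarrow> bool" where
  "has_result l \<tau> res \<longleftrightarrow> (case res of
       None \<Rightarrow> outtape \<tau> = []
     | Some \<delta> \<Rightarrow> fits l \<delta> \<and> outtape \<tau> = rat_digits l \<delta>)"

end

theory Submission
  imports Defs
begin

text \<open>
  Call a state of layer \<open>i\<close> hit if it is \<open>B[v\<^sub>0, H(x)\<^bsub>1..i\<^esub>]\<close> for some seed \<open>x\<close>. A program of width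
  \<open>w\<close> can test whether layer \<open>i\<close> is passed in an unhit state, and no output of \<open>H\<close> meets the test; hence a
  random walk is in an unhit state of layer \<open>i\<close> with probability less than \<open>\<epsilon>\<close>. A program of
  width \<open>w\<^sup>2\<close> runs \<open>B\<close> from two states in parallel, so if no output of the generator separates
  two states, which is decidable by queries, their acceptance probabilities differ by at most \<open>\<epsilon>\<close>.

  The algorithm checks that an estimate agrees up to \<open>5 \<epsilon>\<close> with the average of the estimates of
  all seeds not separated from the two successors, where a successor may also be taken to be
  unhit and then only has a value between \<open>0\<close> and \<open>1\<close>. Good estimates pass, since
  \<open>2 \<epsilon> + 2 \<epsilon> + \<epsilon> = 5 \<epsilon>\<close>. Conversely, along a random walk each step costs \<open>5 \<epsilon>\<close> and the
  probability of entering an unhit state, so the error at the start state is at most \<open>6 \<epsilon> n\<close>.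

  The estimates are too long for the registers. The sign of a fixed polynomial in four fractions
  is found by adding the products of single digits in the order of their weight, halving after
  each weight: the sum is nonnegative iff the final carry is, and carries are polynomially bounded.
\<close>

section \<open>Uniform bits and branching programs\<close>

lemma finite_cube [simp]: "finite (cube n)"
  using finite_lists_length_eq[of "UNIV :: bool set" n] by (simp add: cube_def)

lemma card_cube: "card (cube n) = 2 ^ n"
  using card_lists_length_eq[of "UNIV :: bool set" n] by (simp add: cube_def)

lemma cube_nonempty [simp]: "cube n \<noteq> {}"
  using card_cube[of n] by (metis card.empty power_not_zero zero_neq_numeral)

lemma cube_0: "cube 0 = {[]}"
  by (auto simp: cube_def)

lemma uniform_prob_card: "uniform_prob n f = card {x \<in> cube n. f x} / 2 ^ n"
  by (simp add: uniform_prob_def measure_pmf_of_set card_cube Int_def)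

lemma uniform_prob_0: "uniform_prob 0 f = of_bool (f [])"
proof -
  have "{x \<in> cube 0. f x} = (if f [] then {[]} else {})" by (auto simp: cube_0)
  thus ?thesis by (simp add: uniform_prob_card)
qed

lemma uniform_prob_Suc:
  "uniform_prob (Suc n) f =
     (uniform_prob n (\<lambda>x. f (False # x)) + uniform_prob n (\<lambda>x. f (True # x))) / 2"
proof -
  let ?A = "\<lambda>b. {x \<in> cube n. f (b # x)}"
  have "x \<in> Cons False ` ?A False \<union> Cons True ` ?A True" if "x \<in> cube (Suc n)" "f x" for x
    using that by (cases x; cases "hd x") (auto simp: cube_def)
  hence "{x \<in> cube (Suc n). f x} = Cons False ` ?A False \<union> Cons True ` ?A True"
    by (auto simp: cube_def)
  moreover have "card (Cons False ` ?A False \<union> Cons True ` ?A True) = card (?A False) + card (?A True)"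
    by (subst card_Un_disjoint) (auto simp: card_image)
  ultimately show ?thesis by (simp add: uniform_prob_card field_simps)
qed

lemma uniform_prob_bounds: "0 \<le> uniform_prob n f" "uniform_prob n f \<le> 1"
  by (simp_all add: uniform_prob_def)

lemma uniform_prob_take: "uniform_prob (m + k) (\<lambda>z. f (take m z)) = uniform_prob m f"
proof (induction m arbitrary: f)
  case 0
  have "{x. f []} = (if f [] then UNIV else {})" by simp
  thus ?case by (simp add: uniform_prob_0) (simp add: uniform_prob_def)
next
  case (Suc m)
  from Suc[of "\<lambda>x. f (False # x)"] Suc[of "\<lambda>x. f (True # x)"]
  show ?case by (simp add: uniform_prob_Suc)
qed

lemma uniform_prob_drop: "uniform_prob (m + k) (\<lambda>z. f (drop m z)) = uniform_prob k f"
  by (induction m) (simp_all add: uniform_prob_Suc)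

text \<open>Averaging over the first bit preserves the triangle inequality, so the bound for the two
  halves gives the bound for the whole.\<close>

lemma uniform_prob_diff_le:
  "\<bar>uniform_prob k f - uniform_prob k g\<bar> \<le> uniform_prob k (\<lambda>z. f z \<noteq> g z)"
proof (induction k arbitrary: f g)
  case (Suc k)
  from Suc[of "\<lambda>x. f (False # x)" "\<lambda>x. g (False # x)"] Suc[of "\<lambda>x. f (True # x)" "\<lambda>x. g (True # x)"]
  show ?case by (simp add: uniform_prob_Suc abs_le_iff field_simps)
qed (simp add: uniform_prob_0)

section \<open>Acceptance probabilities and walks through the layers\<close>

lemma accept_prob_0: "accept_prob B 0 v = of_bool (label B v)"
  by (simp add: accept_prob_def uniform_prob_0 walk_def)

lemma accept_prob_Suc:
  "accept_prob B (Suc k) v = (accept_prob B k (edge B v False) + accept_prob B k (edge B v True)) / 2"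
  by (simp add: accept_prob_def uniform_prob_Suc walk_def)

lemma accept_prob_bounds: "0 \<le> accept_prob B k v" "accept_prob B k v \<le> 1"
  by (simp_all add: accept_prob_def uniform_prob_bounds)

lemma walk_append: "walk B v (xs @ ys) = walk B (walk B v xs) ys"
  by (simp add: walk_def)

lemma walk_in_layer:
  assumes "is_obp n w B" "v \<in> layer B i" "i + length z \<le> n"
  shows "walk B v z \<in> layer B (i + length z)"
  using assms(2,3)
proof (induction z arbitrary: v i)
  case (Cons b z)
  have "edge B v b \<in> layer B (Suc i)" using assms(1) Cons.prems by (auto simp: is_obp_def)
  from Cons.IH[OF this] Cons.prems show ?case by (simp add: walk_def)
qed (simp add: walk_def)

lemma width_pos:
  assumes "is_obp n w B"
  shows "0 < w"
proof -
  have "card (layer B 0) \<noteq> 0" using assms by (auto simp: is_obp_def)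
  moreover have "card (layer B 0) \<le> w" using assms by (simp add: is_obp_def)
  ultimately show ?thesis by simp
qed

section \<open>Test programs given by position-dependent transitions\<close>

fun layered_walk :: "(nat \<Rightarrow> nat \<Rightarrow> bool \<Rightarrow> nat) \<Rightarrow> nat \<Rightarrow> nat \<Rightarrow> bool list \<Rightarrow> nat" where
  "layered_walk f i a [] = a"
| "layered_walk f i a (b # z) = layered_walk f (Suc i) (f i a b) z"

text \<open>Tagging the states with their layer makes the layers disjoint.\<close>

lemma layered_in_obp_functions:
  assumes A: "\<And>i. i \<le> n \<Longrightarrow> finite (A i) \<and> card (A i) \<le> w" and "a \<in> A 0"
    and f: "\<And>i v b. i < n \<Longrightarrow> v \<in> A i \<Longrightarrow> f i v b \<in> A (Suc i)"
  shows "\<exists>F\<in>obp_functions n w. \<forall>z\<in>cube n. F z \<longleftrightarrow> g (layered_walk f 0 a z)"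
proof -
  define D where "D = \<lparr>layer = (\<lambda>i. (\<lambda>v. prod_encode (i, v)) ` A i), start = prod_encode (0, a),
    edge = (\<lambda>c b. case prod_decode c of (i, v) \<Rightarrow> prod_encode (Suc i, f i v b)),
    label = (\<lambda>c. g (snd (prod_decode c)))\<rparr>"
  have inj: "inj_on (\<lambda>v. prod_encode (i, v)) (A i)" for i
    by (auto simp: inj_on_def)
  have "is_obp n w D"
    using assms by (auto simp: is_obp_def D_def card_image[OF inj])
  moreover have "foldl (edge D) (prod_encode (i, v)) z = prod_encode (i + length z, layered_walk f i v z)"
    for i v z
    by (induction z arbitrary: i v) (simp_all add: D_def)
  hence "obp_eval D z = g (layered_walk f 0 a z)" for z
    by (simp add: obp_eval_def walk_def) (simp add: D_def)
  ultimately show ?thesis by (auto simp: obp_functions_def)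
qed

lemma uniform_prob_cong:
  assumes "\<And>z. z \<in> cube n \<Longrightarrow> f z = g z"
  shows "uniform_prob n f = uniform_prob n g"
proof -
  have "{x \<in> cube n. f x} = {x \<in> cube n. g x}" using assms by auto
  thus ?thesis by (simp add: uniform_prob_card)
qed

section \<open>Seeds in binary notation\<close>

lemma length_digits [simp]: "length (digits l X) = l"
  by (simp add: digits_def)

lemma digits_in_cube [simp]: "digits s X \<in> cube s"
  by (simp add: cube_def)

lemma digits_surj:
  assumes "y \<in> cube s"
  shows "\<exists>X<2 ^ s. digits s X = y"
proof (intro exI conjI)
  let ?X = "horner_sum of_bool 2 y :: nat"
  show "?X < 2 ^ s"
    using assms horner_sum_of_bool_2_less[of y] by (simp add: cube_def)
  show "digits s ?X = y"
    using assms by (intro nth_equalityI) (auto simp: digits_def cube_def bit_horner_sum_bit_iff)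
qed

section \<open>Consequences of the hitting property for one program\<close>

locale hitting_setting =
  fixes n s w :: nat and \<epsilon> :: real and H :: "bool list \<Rightarrow> bool list" and B :: obp
  assumes hsg: "hitting_set_generator \<epsilon> n s (obp_functions n (w ^ 2)) H"
    and obp: "is_obp n w B"
begin

definition seed :: "nat \<Rightarrow> bool list" where
  "seed X = H (digits s X)"

definition reached :: "nat \<Rightarrow> nat \<Rightarrow> nat" where
  "reached i X = walk B (start B) (take i (seed X))"

text \<open>States of \<open>B\<close> are not accessible, only answers to queries. Hence the
  \<open>b\<close>-successor of the state reached by \<open>X\<close> and the state reached by
  \<open>Y\<close> are represented by prefixes leading to them, and are compared on the suffixes of
  all generator outputs.\<close>

definition indist :: "nat \<Rightarrow> nat \<Rightarrow> bool \<Rightarrow> nat \<Rightarrow> bool" where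
  "indist i X b Y \<longleftrightarrow> (\<forall>Z<2 ^ s.
     obp_eval B (take i (seed X) @ b # drop (Suc i) (seed Z)) =
     obp_eval B (take (Suc i) (seed Y) @ drop (Suc i) (seed Z)))"

lemma length_seed [simp]: "length (seed X) = n"
  using hsg by (auto simp: hitting_set_generator_def seed_def cube_def)

text \<open>The form in which the generator is used: to bound an event, exhibit a layered program of
  width \<open>w ^ 2\<close> that tests it and check that no seed triggers it.\<close>

lemma hit:
  assumes "\<And>i. i \<le> n \<Longrightarrow> finite (A i) \<and> card (A i) \<le> w ^ 2" "a \<in> A 0"
    and "\<And>i v b. i < n \<Longrightarrow> v \<in> A i \<Longrightarrow> f i v b \<in> A (Suc i)"
    and "uniform_prob n (\<lambda>z. g (layered_walk f 0 a z)) \<ge> \<epsilon>"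
  shows "\<exists>Z<2 ^ s. g (layered_walk f 0 a (seed Z))"
proof -
  from layered_in_obp_functions[of n A "w^2" a f g] assms(1-3)
  obtain F where F: "F \<in> obp_functions n (w ^ 2)" "\<forall>z\<in>cube n. F z \<longleftrightarrow> g (layered_walk f 0 a z)"
    by blast
  have "uniform_prob n F \<ge> \<epsilon>" using F(2) assms(4) uniform_prob_cong[of n F] by metis
  then obtain y where "y \<in> cube s" "F (H y)"
    using hsg F(1) by (auto simp: hitting_set_generator_def)
  moreover from \<open>y \<in> cube s\<close> obtain Z where "Z < 2 ^ s" "digits s Z = y"
    using digits_surj by blast
  ultimately have "F (seed Z)" by (simp add: seed_def)
  moreover have "seed Z \<in> cube n" by (simp add: cube_def)
  ultimately show ?thesis using F(2) \<open>Z < 2 ^ s\<close> by blast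
qed

text \<open>For \<epsilon> \<le> 0 the program that always rejects would have to be hit.\<close>

lemma eps_pos: "0 < \<epsilon>"
proof (rule ccontr)
  assume "\<not> 0 < \<epsilon>"
  hence "\<exists>Z<2 ^ s. False"
    using hit[of "\<lambda>_. {0}" 0 "\<lambda>_ _ _. 0" "\<lambda>_. False"] width_pos[OF obp] by (simp add: uniform_prob_def)
  thus False by simp
qed

lemma reached_in_layer:
  assumes "i \<le> n"
  shows "reached i X \<in> layer B i"
  using walk_in_layer[OF obp, of "start B" 0 "take i (seed X)"] assms obp
  by (auto simp: reached_def is_obp_def)

lemma layered_walk_pair:
  "layered_walk (\<lambda>i c b. case prod_decode c of (u, v) \<Rightarrow>
       if i < m then c else prod_encode (edge B u b, edge B v b)) i (prod_encode (u, v)) z =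
   prod_encode (walk B u (drop (m - i) z), walk B v (drop (m - i) z))"
proof (induction z arbitrary: i u v)
  case (Cons b z)
  thus ?case by (cases "i < m") (simp_all add: walk_def drop_Cons' Suc_diff_Suc[symmetric])
qed (simp add: walk_def)

text \<open>The program that skips \<open>m\<close> bits and then runs \<open>B\<close> from two states in parallel has width
  \<open>w\<^sup>2\<close>; the generator does not hit the event that the two runs end with different labels.\<close>

lemma accept_prob_close:
  assumes "m \<le> n" "u \<in> layer B m" "v \<in> layer B m"
    and same: "\<And>Z. Z < 2 ^ s \<Longrightarrow>
      label B (walk B u (drop m (seed Z))) = label B (walk B v (drop m (seed Z)))"
  shows "\<bar>accept_prob B (n - m) u - accept_prob B (n - m) v\<bar> \<le> \<epsilon>"
proof -
  let ?f = "\<lambda>i c b. case prod_decode c of (u, v) \<Rightarrow>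
    if i < m then c else prod_encode (edge B u b, edge B v b)"
  let ?g = "\<lambda>c. case prod_decode c of (u, v) \<Rightarrow> label B u \<noteq> label B v"
  \<comment> \<open>Up to position \<open>m\<close> the pair just waits, so a single state suffices
    there; from \<open>m\<close> on the states are pairs from one layer of \<open>B\<close>.\<close>
  define A where "A i = (if i < m then {prod_encode (u, v)} else prod_encode ` (layer B i \<times> layer B i))" for i
  have card: "finite (A i) \<and> card (A i) \<le> w ^ 2" if "i \<le> n" for i
  proof -
    have l: "finite (layer B i)" "card (layer B i) \<le> w" using obp that by (auto simp: is_obp_def)
    have "card (prod_encode ` (layer B i \<times> layer B i)) = card (layer B i) ^ 2"
      by (subst card_image) (auto simp: inj_prod_encode card_cartesian_product power2_eq_square)
    thus ?thesis using l width_pos[OF obp] by (auto simp: A_def power_mono)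
  qed
  have start: "prod_encode (u, v) \<in> A 0" using assms by (cases m) (auto simp: A_def)
  have step: "?f i c b \<in> A (Suc i)" if "i < n" "c \<in> A i" for i c b
  proof (cases "i < m")
    case True
    thus ?thesis using that assms by (cases "Suc i = m") (auto simp: A_def)
  next
    case False
    thus ?thesis using that obp by (auto simp: A_def is_obp_def)
  qed
  have "\<not> (\<exists>Z<2 ^ s. ?g (layered_walk ?f 0 (prod_encode (u, v)) (seed Z)))"
    using same by (simp add: layered_walk_pair)
  with hit[of A _ ?f ?g, OF card start step]
  have "uniform_prob n (\<lambda>z. ?g (layered_walk ?f 0 (prod_encode (u, v)) z)) < \<epsilon>" by force
  hence "uniform_prob n (\<lambda>z. label B (walk B u (drop m z)) \<noteq> label B (walk B v (drop m z))) < \<epsilon>"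
    by (simp add: layered_walk_pair)
  hence "uniform_prob (n - m) (\<lambda>z. label B (walk B u z) \<noteq> label B (walk B v z)) < \<epsilon>"
    using uniform_prob_drop[of m "n - m" "\<lambda>z. label B (walk B u z) \<noteq> label B (walk B v z)"] assms(1)
    by simp
  thus ?thesis using uniform_prob_diff_le[of "n - m" "\<lambda>z. label B (walk B u z)" "\<lambda>z. label B (walk B v z)"]
    by (simp add: accept_prob_def)
qed

text \<open>A query splits at the state that its prefix leads to, so agreement of the two queries
  for \<open>Z\<close> is agreement of the labels reached from the two states on the same
  suffix.\<close>

lemma indist_accept_prob:
  assumes "i < n" "indist i X b Y"
  shows "\<bar>accept_prob B (n - Suc i) (edge B (reached i X) b) - accept_prob B (n - Suc i) (reached (Suc i) Y)\<bar> \<le> \<epsilon>"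
proof (rule accept_prob_close)
  show "edge B (reached i X) b \<in> layer B (Suc i)"
    using reached_in_layer[of i X] obp assms(1) by (auto simp: is_obp_def)
  show "reached (Suc i) Y \<in> layer B (Suc i)" using reached_in_layer assms(1) by simp
  fix Z :: nat assume "Z < 2 ^ s"
  with assms(2) show "label B (walk B (edge B (reached i X) b) (drop (Suc i) (seed Z))) =
      label B (walk B (reached (Suc i) Y) (drop (Suc i) (seed Z)))"
    by (simp add: indist_def obp_eval_def reached_def walk_append) (simp add: walk_def)
qed (use assms in auto)

text \<open>Two prefixes leading to the same state cannot be separated by any suffix. Thus a
  successor that is hit has at least one seed among those it is compared with.\<close>

lemma indist_if_edge:
  assumes "reached (Suc i) Y = edge B (reached i X) b"
  shows "indist i X b Y"
  using assms by (simp add: indist_def obp_eval_def reached_def walk_append) (simp add: walk_def)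

section \<open>States that the generator reaches\<close>

definition hit_states :: "nat \<Rightarrow> nat set" where
  "hit_states j = reached j ` {..<2 ^ s}"

lemma layered_walk_freeze:
  "layered_walk (\<lambda>i v b. if i < j then edge B v b else v) i v z = walk B v (take (j - i) z)"
proof (induction z arbitrary: i v)
  case (Cons b z)
  thus ?case by (cases "i < j") (simp_all add: walk_def take_Cons' Suc_diff_Suc[symmetric])
qed (simp add: walk_def)

text \<open>The program that freezes after \<open>j\<close> steps and accepts outside \<open>hit_states j\<close> is never hit,
  by the very definition of \<open>hit_states\<close>.\<close>

lemma miss_prob:
  assumes "j \<le> n"
  shows "uniform_prob j (\<lambda>z. walk B (start B) z \<notin> hit_states j) \<le> \<epsilon>"
proof -
  let ?f = "\<lambda>i v b. if i < j then edge B v b else v"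
  let ?g = "\<lambda>v. v \<notin> hit_states j"
  \<comment> \<open>A single run of \<open>B\<close> needs width \<open>w\<close> only, within the
    class that the generator hits.\<close>
  have "w \<le> w ^ 2" by (simp add: power2_eq_square)
  have 1: "finite (layer B (min i j)) \<and> card (layer B (min i j)) \<le> w ^ 2" if "i \<le> n" for i
    using obp that order_trans[OF _ \<open>w \<le> w ^ 2\<close>] by (auto simp: is_obp_def)
  have 2: "start B \<in> layer B (min 0 j)" using obp by (simp add: is_obp_def)
  have 3: "?f i v b \<in> layer B (min (Suc i) j)" if "i < n" "v \<in> layer B (min i j)" for i v b
    using obp that assms by (auto simp: is_obp_def min_def split: if_splits)
  have "\<not> (\<exists>Z<2 ^ s. ?g (layered_walk ?f 0 (start B) (seed Z)))"
    by (auto simp: layered_walk_freeze hit_states_def reached_def)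
  with hit[of "\<lambda>i. layer B (min i j)" "start B" ?f ?g, OF 1 2 3]
  have "uniform_prob n (\<lambda>z. ?g (layered_walk ?f 0 (start B) z)) < \<epsilon>" by force
  thus ?thesis
    using uniform_prob_take[of j "n - j" "\<lambda>z. ?g (walk B (start B) z)"] assms
    by (simp add: layered_walk_freeze)
qed

section \<open>The consistency test and its error analysis\<close>

context
  fixes p :: "nat \<Rightarrow> nat \<Rightarrow> real"
begin

text \<open>The index \<open>2 ^ s\<close> stands for a successor state that no seed reaches: its value is only
  known to lie between \<open>0\<close> and \<open>1\<close>, so it is replaced by the weaker bound \<open>h\<close>.\<close>

definition estimate :: "bool \<Rightarrow> nat \<Rightarrow> nat \<Rightarrow> real" where
  "estimate h i Y = (if Y < 2 ^ s then p Y i else of_bool h)"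

text \<open>The estimate may differ by 5\<epsilon> from the average of its successors; doubling
  avoids the division. The two directions are separate because the fallback value is 1 when the
  successors bound the estimate from above (\<open>h\<close>) and 0 when they bound it from
  below.\<close>

definition consistent_at :: "bool \<Rightarrow> nat \<Rightarrow> nat \<Rightarrow> nat \<Rightarrow> nat \<Rightarrow> bool" where
  "consistent_at h i X Y0 Y1 \<longleftrightarrow>
     (if h then 2 * p X i - estimate h (Suc i) Y0 - estimate h (Suc i) Y1 \<le> 10 * \<epsilon>
      else estimate h (Suc i) Y0 + estimate h (Suc i) Y1 - 2 * p X i \<le> 10 * \<epsilon>)"

definition consistent :: bool where
  "consistent \<longleftrightarrow> (\<forall>X<2 ^ s. p X n = of_bool (obp_eval B (seed X))) \<and>
    (\<forall>i<n. \<forall>X<2 ^ s. \<forall>Y0<Suc (2 ^ s). \<forall>Y1<Suc (2 ^ s). \<forall>h.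
       (Y0 = 2 ^ s \<or> indist i X False Y0) \<longrightarrow> (Y1 = 2 ^ s \<or> indist i X True Y1) \<longrightarrow>
       consistent_at h i X Y0 Y1)"

lemma good_estimates_consistent:
  assumes est: "\<And>X i. X < 2 ^ s \<Longrightarrow> i < n \<Longrightarrow> \<bar>accept_prob B (n - i) (reached i X) - p X i\<bar> \<le> 2 * \<epsilon>"
    and last: "\<And>X. X < 2 ^ s \<Longrightarrow> p X n = of_bool (obp_eval B (seed X))"
  shows consistent
proof -
  \<comment> \<open>In the last layer the estimates are exact, so the bound extends to
    \<open>i = n\<close> because \<epsilon> is positive.\<close>
  have est': "\<bar>accept_prob B (n - i) (reached i X) - p X i\<bar> \<le> 2 * \<epsilon>" if "X < 2 ^ s" "i \<le> n" for i X
  proof (cases "i = n")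
    case True
    thus ?thesis using last[OF that(1)] eps_pos
      by (simp add: accept_prob_0 reached_def obp_eval_def)
  qed (use est that in simp)
  \<comment> \<open>The 3\<epsilon> is 2\<epsilon> for the estimate of \<open>Y\<close> and
    \<epsilon> from \<open>indist_accept_prob\<close>. At index \<open>2 ^ s\<close> the fallback
    value bounds any probability.\<close>
  have child:
    "if h then accept_prob B (n - Suc i) (edge B (reached i X) b) \<le> estimate h (Suc i) Y + 3 * \<epsilon>
     else estimate h (Suc i) Y - 3 * \<epsilon> \<le> accept_prob B (n - Suc i) (edge B (reached i X) b)"
    if "i < n" "Y = 2 ^ s \<or> indist i X b Y" "Y < Suc (2 ^ s)" for h i X b Y
  proof (cases "Y = 2 ^ s")
    case True
    thus ?thesis using eps_pos accept_prob_bounds[of B "n - Suc i" "edge B (reached i X) b"]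
      by (auto simp: estimate_def)
  next
    case False
    hence "Y < 2 ^ s" using that by simp
    with est'[of Y "Suc i"] indist_accept_prob[of i X b Y] that False
    show ?thesis by (auto simp: estimate_def)
  qed
  have "consistent_at h i X Y0 Y1"
    if A: "i < n" "X < 2 ^ s" "Y0 < Suc (2 ^ s)" "Y1 < Suc (2 ^ s)"
      "Y0 = 2 ^ s \<or> indist i X False Y0" "Y1 = 2 ^ s \<or> indist i X True Y1" for h i X Y0 Y1
  proof -
    have "accept_prob B (n - i) (reached i X) =
      (accept_prob B (n - Suc i) (edge B (reached i X) False)
       + accept_prob B (n - Suc i) (edge B (reached i X) True)) / 2"
      using accept_prob_Suc[of B "n - Suc i"] A(1) by (simp add: Suc_diff_Suc)
    with child[OF A(1,5,3), of h] child[OF A(1,6,4), of h] est'[OF A(2), of i] A(1)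
    show ?thesis by (cases h) (auto simp: consistent_at_def abs_le_iff field_simps)
  qed
  thus ?thesis using last by (auto simp: consistent_def)
qed

text \<open>The expected number of unhit states among the \<open>k\<close> states that follow
  \<open>v\<close> on a random walk, where \<open>v\<close> lies in layer \<open>i\<close>.\<close>

definition miss :: "nat \<Rightarrow> nat \<Rightarrow> nat \<Rightarrow> real" where
  "miss k i v = (\<Sum>j<k. uniform_prob (Suc j) (\<lambda>z. walk B v z \<notin> hit_states (Suc i + j)))"

text \<open>Conditioning on the first bit: the term \<open>j = 0\<close> says whether the successor
  is unhit, and the later terms count from the successor.\<close>

lemma miss_Suc:
  "miss (Suc k) i v = (\<Sum>b\<in>UNIV. of_bool (edge B v b \<notin> hit_states (Suc i)) + miss k (Suc i) (edge B v b)) / 2"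
proof -
  have "miss (Suc k) i v = uniform_prob (Suc 0) (\<lambda>z. walk B v z \<notin> hit_states (Suc i)) +
    (\<Sum>j<k. uniform_prob (Suc (Suc j)) (\<lambda>z. walk B v z \<notin> hit_states (Suc (Suc i) + j)))"
    unfolding miss_def by (subst sum.lessThan_Suc_shift) simp
  also have "\<dots> = (\<Sum>b\<in>UNIV. of_bool (edge B v b \<notin> hit_states (Suc i)) + miss k (Suc i) (edge B v b)) / 2"
    unfolding miss_def uniform_prob_Suc[of "Suc _"]
    by (simp add: uniform_prob_Suc[of 0] uniform_prob_0 walk_def UNIV_bool sum.distrib
        sum_divide_distrib[symmetric] field_simps)
  finally show ?thesis .
qed

text \<open>A successor in \<open>hit_states\<close> costs its own error, any other successor costs at most
  \<open>1\<close>, which is paid for by \<open>miss_prob\<close>.\<close>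

lemma consistent_error:
  assumes consistent "i + k = n" "X < 2 ^ s"
  shows "\<bar>p X i - accept_prob B k (reached i X)\<bar> \<le> 5 * \<epsilon> * real k + miss k i (reached i X)"
  using assms(2,3)
proof (induction k arbitrary: i X)
  case 0
  thus ?case using assms(1)
    by (simp add: consistent_def accept_prob_0 reached_def obp_eval_def miss_def)
next
  case (Suc k)
  let ?v = "\<lambda>b. edge B (reached i X) b"
  \<comment> \<open>An unhit successor is charged 1 on top, which covers either fallback value.
    Averaged over \<open>b\<close>, the last two terms become \<open>miss (Suc k)\<close> by
    \<open>miss_Suc\<close>.\<close>
  let ?err = "\<lambda>b. 5 * \<epsilon> * real k + (of_bool (?v b \<notin> hit_states (Suc i)) + miss k (Suc i) (?v b))"
  have i: "i < n" using Suc.prems by simp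
  have miss_nonneg: "0 \<le> miss k j v" for j v by (simp add: miss_def sum_nonneg uniform_prob_bounds)
  \<comment> \<open>One index has to serve both directions: a seed leading to the successor if there
    is one, otherwise \<open>2 ^ s\<close>.\<close>
  have "\<exists>Y<Suc (2 ^ s). (Y = 2 ^ s \<or> indist i X b Y) \<and>
      estimate False (Suc i) Y \<ge> accept_prob B k (?v b) - ?err b \<and>
      estimate True (Suc i) Y \<le> accept_prob B k (?v b) + ?err b" for b
  proof (cases "?v b \<in> hit_states (Suc i)")
    case True
    then obtain Y where Y: "Y < 2 ^ s" "reached (Suc i) Y = ?v b" by (auto simp: hit_states_def)
    with Suc.IH[of "Suc i" Y] Suc.prems indist_if_edge[OF Y(2)] True
    show ?thesis by (intro exI[of _ Y]) (auto simp: estimate_def)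
  next
    case False
    moreover have "0 \<le> 5 * \<epsilon> * real k" using eps_pos by simp
    ultimately show ?thesis
      using accept_prob_bounds[of B k "?v b"] miss_nonneg[of "Suc i" "?v b"] add_mono
      by (intro exI[of _ "2 ^ s"]) (auto simp: estimate_def)
  qed
  then obtain Y where Y: "\<And>b. Y b < Suc (2 ^ s)" "\<And>b. Y b = 2 ^ s \<or> indist i X b (Y b)"
    "\<And>b. estimate False (Suc i) (Y b) \<ge> accept_prob B k (?v b) - ?err b"
    "\<And>b. estimate True (Suc i) (Y b) \<le> accept_prob B k (?v b) + ?err b"
    by metis
  have "consistent_at h i X (Y False) (Y True)" for h
    using assms(1) i Suc.prems(2) Y(1,2) unfolding consistent_def by blast
  from this[of False] this[of True]
  show ?case using Y(3,4)[of False] Y(3,4)[of True]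
    by (simp add: consistent_at_def miss_Suc accept_prob_Suc UNIV_bool abs_le_iff field_simps)
qed

text \<open>The empty prefix of seed 0 leads to the start state, so \<open>p 0 0\<close> estimates
  the acceptance probability of the whole program.\<close>

lemma consistent_sound:
  assumes consistent
  shows "\<bar>uniform_prob n (obp_eval B) - p 0 0\<bar> \<le> 6 * \<epsilon> * real n"
proof -
  have start: "reached 0 0 = start B" by (simp add: reached_def walk_def)
  have "uniform_prob n (obp_eval B) = accept_prob B n (start B)"
    by (simp add: accept_prob_def obp_eval_def[abs_def])
  \<comment> \<open>By \<open>miss_prob\<close> each of the \<open>n\<close> layers contributes at
    most \<epsilon>, which turns 5\<epsilon> per step into 6\<epsilon>.\<close>
  moreover have "miss n 0 (start B) \<le> (\<Sum>j<n. \<epsilon>)"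
    unfolding miss_def by (intro sum_mono) (use miss_prob in auto)
  ultimately show ?thesis
    using consistent_error[OF assms, of 0 n 0] by (simp add: start algebra_simps)
qed

end

end

section \<open>Structured programs within a space bound\<close>

fun below :: "nat \<Rightarrow> expr \<Rightarrow> bool" where
  "below d (Num k) = True"
| "below d (Reg r) = (r < d)"
| "below d (Plus a b) = (below d a \<and> below d b)"
| "below d (Minus a b) = (below d a \<and> below d b)"
| "below d (Times a b) = (below d a \<and> below d b)"
| "below d (Div a b) = (below d a \<and> below d b)"
| "below d (Mod a b) = (below d a \<and> below d b)"
| "below d (Less a b) = (below d a \<and> below d b)"

lemma expr_val_agree:
  assumes "\<And>r. r < d \<Longrightarrow> \<rho> r = \<rho>' r" "below d e"
  shows "expr_val \<rho> e = expr_val \<rho>' e"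
  using assms(2) by (induction e) (simp_all add: assms(1))

text \<open>A let-binding: the value of \<open>c1\<close> stays in register \<open>d\<close> while
  \<open>c2\<close> computes at depth \<open>d + 1\<close>; the result is then moved down.\<close>

definition Then :: "nat \<Rightarrow> com \<Rightarrow> com \<Rightarrow> com" where
  "Then d c1 c2 = Seq c1 (Seq c2 (Assign d (Reg (d + 1))))"

text \<open>In the body of a loop at depth \<open>d\<close>, register \<open>d\<close> is the accumulator and register
  \<open>d + 1\<close> the counter.\<close>

definition Fold :: "nat \<Rightarrow> com \<Rightarrow> expr \<Rightarrow> com \<Rightarrow> com" where
  "Fold d c0 b c = Seq c0 (Seq (Assign (d + 1) (Num 0))
     (While (Less (Reg (d + 1)) b)
       (Seq c (Seq (Assign d (Reg (d + 2))) (Assign (d + 1) (Plus (Reg (d + 1)) (Num 1)))))))"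

definition All :: "nat \<Rightarrow> expr \<Rightarrow> com \<Rightarrow> com" where
  "All d b c = Fold d (Assign d (Num 1)) b
     (Seq c (If (Reg (d + 2)) (Assign (d + 2) (Reg d)) (Assign (d + 2) (Num 0))))"

text \<open>Register \<open>d\<close> counts the positions of the query and finally receives the
  answer.\<close>

definition Ask :: "nat \<Rightarrow> expr \<Rightarrow> com \<Rightarrow> com" where
  "Ask d b c = Seq (Assign d (Num 0)) (Seq (While (Less (Reg d) b)
     (Seq c (Seq (PutQuery (Reg (d + 1))) (Assign d (Plus (Reg d) (Num 1)))))) (AskQuery d))"

definition Emit :: "nat \<Rightarrow> expr \<Rightarrow> com \<Rightarrow> com" where
  "Emit d b c = Seq (Assign d (Num 0)) (While (Less (Reg d) b)
     (Seq c (Seq (PutOutput (Reg (d + 1))) (Assign d (Plus (Reg d) (Num 1))))))"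

text \<open>Code that computes a value at depth \<open>d\<close> leaves it in register \<open>d\<close>, keeps the registers
  below \<open>d\<close>, and may use those above \<open>d\<close> as scratch space; registers below \<open>d\<close> thus play the role
  of bound variables. \<open>M\<close> bounds the contents of all registers and \<open>K\<close> the space of a
  subroutine call.\<close>

locale machine =
  fixes E :: env and M R K :: nat
begin

definition good :: "state \<Rightarrow> bool" where
  "good \<sigma> \<longleftrightarrow> (\<forall>r. regs \<sigma> r \<le> M) \<and> (\<forall>r\<ge>R. regs \<sigma> r = 0)"

text \<open>The three summands are the charges of a call: the registers of the caller, the run of
  the subroutine, and the counter for the output position.\<close>

definition S :: nat where
  "S = R * floorlog 2 M + K + floorlog 2 M"

definition agree :: "nat \<Rightarrow> (nat \<Rightarrow> nat) \<Rightarrow> state \<Rightarrow> bool" where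
  "agree d \<rho> \<sigma> \<longleftrightarrow> (\<forall>r<d. regs \<sigma> r = \<rho> r)"

definition runs :: "com \<Rightarrow> state \<Rightarrow> state \<Rightarrow> bool" where
  "runs c \<sigma> \<tau> \<longleftrightarrow> (\<exists>m\<le>S. exec E c \<sigma> \<tau> m)"

text \<open>Preserving the tapes is part of the specification because bits are computed while a
  query or the output is half written.\<close>

definition evals :: "bool list \<Rightarrow> nat \<Rightarrow> (nat \<Rightarrow> nat) \<Rightarrow> com \<Rightarrow> nat \<Rightarrow> bool" where
  "evals q d \<rho> c v \<longleftrightarrow> (\<forall>\<sigma>. good \<sigma> \<longrightarrow> agree d \<rho> \<sigma> \<longrightarrow> qtape \<sigma> = q \<longrightarrow>
     (\<exists>\<tau>. runs c \<sigma> \<tau> \<and> good \<tau> \<and> agree (Suc d) (\<rho>(d := v)) \<tau> \<and> qtape \<tau> = q \<and>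
       outtape \<tau> = outtape \<sigma>))"

section \<open>Space used by single commands and loops\<close>

lemma space_of_good:
  assumes "good \<sigma>"
  shows "space_of \<sigma> \<le> R * floorlog 2 M"
proof -
  have "{r. regs \<sigma> r \<noteq> 0} \<subseteq> {..<R}" using assms by (auto simp: good_def not_less[symmetric])
  hence "space_of \<sigma> \<le> (\<Sum>r<R. floorlog 2 (regs \<sigma> r))"
    unfolding space_of_def by (intro sum_mono2) auto
  also have "\<dots> \<le> (\<Sum>r<R. floorlog 2 M)"
    using assms by (intro sum_mono floorlog_mono) (auto simp: good_def)
  finally show ?thesis by simp
qed

lemma space_of_good': "good \<sigma> \<Longrightarrow> space_of \<sigma> \<le> S"
  using space_of_good[of \<sigma>] by (simp add: S_def)

lemma good_set_reg: "good \<sigma> \<Longrightarrow> r < R \<Longrightarrow> a \<le> M \<Longrightarrow> good (set_reg r a \<sigma>)"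
  by (auto simp: good_def set_reg_def)

lemma agree_set_reg: "agree d \<rho> \<sigma> \<Longrightarrow> agree (Suc d) (\<rho>(d := v)) (set_reg d v \<sigma>)"
  by (auto simp: agree_def set_reg_def)

lemma set_reg_simps [simp]:
  "regs (set_reg r a \<sigma>) = (regs \<sigma>)(r := a)"
  "qtape (set_reg r a \<sigma>) = qtape \<sigma>" "outtape (set_reg r a \<sigma>) = outtape \<sigma>"
  by (simp_all add: set_reg_def)

lemma good_cong: "good \<sigma> \<Longrightarrow> regs \<tau> = regs \<sigma> \<Longrightarrow> good \<tau>"
  by (simp add: good_def)

lemma val_agree: "agree d \<rho> \<sigma> \<Longrightarrow> below d e \<Longrightarrow> val \<sigma> e = expr_val \<rho> e"
  by (rule expr_val_agree) (auto simp: agree_def)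

lemma runs_Skip: "good \<sigma> \<Longrightarrow> runs Skip \<sigma> \<sigma>"
  unfolding runs_def using exec.Skip space_of_good' by blast

lemma runs_Seq: "runs c1 \<sigma> \<rho> \<Longrightarrow> runs c2 \<rho> \<tau> \<Longrightarrow> runs (Seq c1 c2) \<sigma> \<tau>"
  unfolding runs_def using exec.Seq by (metis max.bounded_iff)

lemma runs_If:
  "runs (if val \<sigma> e \<noteq> 0 then c1 else c2) \<sigma> \<tau> \<Longrightarrow> runs (If e c1 c2) \<sigma> \<tau>"
  unfolding runs_def using exec.IfTrue exec.IfFalse by (metis (full_types))

lemma runs_Assign:
  assumes "good \<sigma>" "r < R" "val \<sigma> e \<le> M"
  shows "runs (Assign r e) \<sigma> (set_reg r (val \<sigma> e) \<sigma>)"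
  unfolding runs_def using exec.Assign[OF refl, where r = r and \<sigma> = \<sigma> and e = e]
    space_of_good'[OF assms(1)] space_of_good'[OF good_set_reg[OF assms]] by (meson max.boundedI)

lemma runs_ReadInput:
  assumes "good \<sigma>" "r < R" "1 \<le> M"
  shows "runs (ReadInput r e) \<sigma> (set_reg r (of_bool (input_bit (in_tape E) (val \<sigma> e))) \<sigma>)"
  unfolding runs_def using exec.ReadInput[OF refl, where r = r and \<sigma> = \<sigma> and e = e]
    space_of_good'[OF assms(1)]
    space_of_good'[OF good_set_reg[OF assms(1,2), of "of_bool _"]] assms(3)
  by (metis le_trans max.boundedI of_bool_less_eq_one)

lemma runs_PutQuery: "good \<sigma> \<Longrightarrow> runs (PutQuery e) \<sigma> (put_query (val \<sigma> e \<noteq> 0) \<sigma>)"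
  unfolding runs_def using exec.PutQuery space_of_good' by blast

lemma runs_PutOutput: "good \<sigma> \<Longrightarrow> runs (PutOutput e) \<sigma> (put_output (val \<sigma> e \<noteq> 0) \<sigma>)"
  unfolding runs_def using exec.PutOutput space_of_good' by blast

text \<open>\<open>I j\<close> is the invariant after exactly \<open>j\<close> rounds; fixing the
  number \<open>N\<close> of rounds yields termination as well.\<close>

lemma runs_While:
  assumes "I 0 \<sigma>"
    and cond: "\<And>j \<sigma>. I j \<sigma> \<Longrightarrow> good \<sigma> \<and> (val \<sigma> e \<noteq> 0 \<longleftrightarrow> j < N)"
    and step: "\<And>j \<sigma>. j < N \<Longrightarrow> I j \<sigma> \<Longrightarrow> \<exists>\<tau>. runs c \<sigma> \<tau> \<and> I (Suc j) \<tau>"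
  shows "\<exists>\<tau>. runs (While e c) \<sigma> \<tau> \<and> I N \<tau>"
proof -
  have "\<exists>\<tau>. runs (While e c) \<sigma> \<tau> \<and> I N \<tau>" if "j \<le> N" "I j \<sigma>" for j \<sigma>
    using that
  \<comment> \<open>Downward from \<open>N\<close>: what remains of the loop after round
    \<open>j\<close> starts with invariant \<open>Suc j\<close>.\<close>
  proof (induction j arbitrary: \<sigma> rule: inc_induct)
    case base
    thus ?case
      using cond[OF base] exec.WhileFalse[of \<sigma> e E c] space_of_good'[of \<sigma>]
      unfolding runs_def by blast
  next
    case (step j)
    from assms(3)[OF step.hyps(2) step.prems] obtain \<rho> where
      \<rho>: "runs c \<sigma> \<rho>" "I (Suc j) \<rho>" by blast
    with step.IH obtain \<tau> where \<tau>: "runs (While e c) \<rho> \<tau>" "I N \<tau>" by blast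
    have "val \<sigma> e \<noteq> 0" using cond[OF step.prems] step.hyps(2) by simp
    with \<rho>(1) \<tau>(1) have "runs (While e c) \<sigma> \<tau>"
      unfolding runs_def using exec.WhileTrue by (metis max.bounded_iff)
    with \<tau>(2) show ?case by blast
  qed
  from this[of 0 \<sigma>] assms(1) show ?thesis by simp
qed

section \<open>Rules for the values computed by structured code\<close>

lemma evals_Assign:
  assumes "below d e" "d < R" "expr_val \<rho> e \<le> M" "expr_val \<rho> e = v"
  shows "evals q d \<rho> (Assign d e) v"
  unfolding evals_def
proof (intro allI impI)
  fix \<sigma> assume \<sigma>: "good \<sigma>" "agree d \<rho> \<sigma>" "qtape \<sigma> = q"
  have v: "val \<sigma> e = v" using val_agree[OF \<sigma>(2) assms(1)] assms(4) by simp
  show "\<exists>\<tau>. runs (Assign d e) \<sigma> \<tau> \<and> good \<tau> \<and> agree (Suc d) (\<rho>(d := v)) \<tau> \<and> qtape \<tau> = q \<and>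
      outtape \<tau> = outtape \<sigma>"
    using runs_Assign[OF \<sigma>(1) assms(2), of e] good_set_reg[OF \<sigma>(1) assms(2), of v]
      agree_set_reg[OF \<sigma>(2), of v] \<sigma>(3) assms(3,4) v by auto
qed

lemma evals_ReadInput:
  assumes "below d e" "d < R" "1 \<le> M" "input_bit (in_tape E) (expr_val \<rho> e) = b"
  shows "evals q d \<rho> (ReadInput d e) (of_bool b)"
  unfolding evals_def
proof (intro allI impI)
  fix \<sigma> assume \<sigma>: "good \<sigma>" "agree d \<rho> \<sigma>" "qtape \<sigma> = q"
  have v: "val \<sigma> e = expr_val \<rho> e" using val_agree[OF \<sigma>(2) assms(1)] .
  show "\<exists>\<tau>. runs (ReadInput d e) \<sigma> \<tau> \<and> good \<tau> \<and> agree (Suc d) (\<rho>(d := of_bool b)) \<tau> \<and> qtape \<tau> = q \<and>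
      outtape \<tau> = outtape \<sigma>"
    using runs_ReadInput[OF \<sigma>(1) assms(2,3), of e] good_set_reg[OF \<sigma>(1) assms(2), of "of_bool b"]
      agree_set_reg[OF \<sigma>(2), of "of_bool b"] \<sigma>(3) assms(3,4) v by auto
qed

lemma evals_CallBit:
  assumes "below d a" "below d e" "d < R" "1 \<le> M" "expr_val \<rho> e \<le> M"
    and sub: "sub_runs E (expr_val \<rho> a) xs m" "m \<le> K" "expr_val \<rho> e < length xs" "xs ! expr_val \<rho> e = b"
  shows "evals q d \<rho> (CallBit d a e) (of_bool b)"
  unfolding evals_def
proof (intro allI impI)
  fix \<sigma> assume \<sigma>: "good \<sigma>" "agree d \<rho> \<sigma>" "qtape \<sigma> = q"
  have v: "val \<sigma> e = expr_val \<rho> e" "val \<sigma> a = expr_val \<rho> a"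
    using val_agree[OF \<sigma>(2)] assms(1,2) by simp_all
  define \<tau> where "\<tau> = set_reg d (of_bool b) \<sigma>"
  have \<tau>: "good \<tau>" "agree (Suc d) (\<rho>(d := of_bool b)) \<tau>"
    using good_set_reg[OF \<sigma>(1) assms(3), of "of_bool b"] agree_set_reg[OF \<sigma>(2)] assms(4)
    by (auto simp: \<tau>_def)
  have "exec E (CallBit d a e) \<sigma> \<tau> (max (space_of \<sigma> + m + floorlog 2 (val \<sigma> e)) (space_of \<tau>))"
    using sub v by (intro exec.CallBit[where xs = xs]) (auto simp: \<tau>_def)
  moreover have "max (space_of \<sigma> + m + floorlog 2 (val \<sigma> e)) (space_of \<tau>) \<le> S"
    using space_of_good[OF \<sigma>(1)] space_of_good'[OF \<tau>(1)] sub(2) v(1) floorlog_mono[OF assms(5), of 2]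
    by (simp add: S_def)
  ultimately show "\<exists>\<tau>. runs (CallBit d a e) \<sigma> \<tau> \<and> good \<tau> \<and> agree (Suc d) (\<rho>(d := of_bool b)) \<tau> \<and>
      qtape \<tau> = q \<and> outtape \<tau> = outtape \<sigma>"
    using \<tau> \<sigma>(3) unfolding runs_def by (intro exI[of _ \<tau>] conjI) (blast | simp add: \<tau>_def)+
qed

lemma evals_If:
  assumes "below d e" "evals q d \<rho> (if expr_val \<rho> e \<noteq> 0 then c1 else c2) v"
  shows "evals q d \<rho> (If e c1 c2) v"
  unfolding evals_def
proof (intro allI impI)
  fix \<sigma> assume \<sigma>: "good \<sigma>" "agree d \<rho> \<sigma>" "qtape \<sigma> = q"
  show "\<exists>\<tau>. runs (If e c1 c2) \<sigma> \<tau> \<and> good \<tau> \<and> agree (Suc d) (\<rho>(d := v)) \<tau> \<and> qtape \<tau> = q \<and>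
      outtape \<tau> = outtape \<sigma>"
    using assms(2) \<sigma> runs_If[of \<sigma> e c1 c2] val_agree[OF \<sigma>(2) assms(1)] unfolding evals_def by metis
qed

lemma evals_Then:
  assumes "evals q d \<rho> c1 u" "evals q d' (\<rho>(d := u)) c2 v" "d' = Suc d" "d' < R"
  shows "evals q d \<rho> (Then d c1 c2) v"
  unfolding evals_def Then_def Suc_eq_plus1[symmetric]
proof (intro allI impI)
  fix \<sigma> assume \<sigma>: "good \<sigma>" "agree d \<rho> \<sigma>" "qtape \<sigma> = q"
  then obtain \<sigma>1 where 1: "runs c1 \<sigma> \<sigma>1" "good \<sigma>1" "agree (Suc d) (\<rho>(d := u)) \<sigma>1" "qtape \<sigma>1 = q"
    "outtape \<sigma>1 = outtape \<sigma>" using assms(1) unfolding evals_def by blast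
  then obtain \<sigma>2 where 2: "runs c2 \<sigma>1 \<sigma>2" "good \<sigma>2" "agree (Suc (Suc d)) (\<rho>(d := u, Suc d := v)) \<sigma>2"
    "qtape \<sigma>2 = q" "outtape \<sigma>2 = outtape \<sigma>"
    using assms(2) unfolding evals_def assms(3) by metis
  have v: "regs \<sigma>2 (Suc d) = v" using 2(3) by (simp add: agree_def)
  hence "v \<le> M" using 2(2) by (auto simp: good_def)
  moreover have "agree d \<rho> \<sigma>2" using 2(3) by (simp add: agree_def)
  ultimately show "\<exists>\<tau>. runs (Seq c1 (Seq c2 (Assign d (Reg (Suc d))))) \<sigma> \<tau> \<and> good \<tau> \<and>
      agree (Suc d) (\<rho>(d := v)) \<tau> \<and> qtape \<tau> = q \<and> outtape \<tau> = outtape \<sigma>"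
    using runs_Seq[OF 1(1) runs_Seq[OF 2(1) runs_Assign[OF 2(2), of d "Reg (Suc d)"]]]
      agree_set_reg[of d \<rho> \<sigma>2 v] good_set_reg[OF 2(2), of d v] assms(3,4) 2(4,5) v
    by auto
qed

lemma evals_Cond:
  assumes "evals q d \<rho> c u" "evals q d \<rho> (if u \<noteq> 0 then c1 else c2) v"
  shows "evals q d \<rho> (Seq c (If (Reg d) c1 c2)) v"
  unfolding evals_def
proof (intro allI impI)
  fix \<sigma> assume \<sigma>: "good \<sigma>" "agree d \<rho> \<sigma>" "qtape \<sigma> = q"
  then obtain \<sigma>1 where 1: "runs c \<sigma> \<sigma>1" "good \<sigma>1" "agree (Suc d) (\<rho>(d := u)) \<sigma>1" "qtape \<sigma>1 = q"
    "outtape \<sigma>1 = outtape \<sigma>" using assms(1) unfolding evals_def by blast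
  have u: "val \<sigma>1 (Reg d) = u" and "agree d \<rho> \<sigma>1" using 1(3) by (simp_all add: agree_def)
  then obtain \<sigma>2 where 2: "runs (if u \<noteq> 0 then c1 else c2) \<sigma>1 \<sigma>2" "good \<sigma>2"
    "agree (Suc d) (\<rho>(d := v)) \<sigma>2" "qtape \<sigma>2 = q" "outtape \<sigma>2 = outtape \<sigma>"
    using assms(2) 1 unfolding evals_def by metis
  thus "\<exists>\<tau>. runs (Seq c (If (Reg d) c1 c2)) \<sigma> \<tau> \<and> good \<tau> \<and>
      agree (Suc d) (\<rho>(d := v)) \<tau> \<and> qtape \<tau> = q \<and> outtape \<tau> = outtape \<sigma>"
    using runs_Seq[OF 1(1) runs_If[of \<sigma>1 "Reg d" c1 c2]] u by metis
qed

lemma evals_conj: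
  assumes "evals q d \<rho> c (of_bool a)" "evals q d \<rho> c1 (of_bool b)" "d < R"
  shows "evals q d \<rho> (Seq c (If (Reg d) c1 (Assign d (Num 0)))) (of_bool (a \<and> b))"
proof (rule evals_Cond[OF assms(1)])
  have "evals q d \<rho> (Assign d (Num 0)) 0" using assms(3) by (intro evals_Assign) auto
  thus "evals q d \<rho> (if of_bool a \<noteq> (0::nat) then c1 else Assign d (Num 0)) (of_bool (a \<and> b))"
    using assms(2) by (cases a) auto
qed

lemma evals_implies:
  assumes "evals q d \<rho> c (of_bool a)" "evals q d \<rho> c1 (of_bool b)" "d < R" "1 \<le> M"
  shows "evals q d \<rho> (Seq c (If (Reg d) c1 (Assign d (Num 1)))) (of_bool (a \<longrightarrow> b))"
proof (rule evals_Cond[OF assms(1)])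
  have "evals q d \<rho> (Assign d (Num 1)) 1" using assms(3,4) by (intro evals_Assign) auto
  thus "evals q d \<rho> (if of_bool a \<noteq> (0::nat) then c1 else Assign d (Num 1)) (of_bool (a \<longrightarrow> b))"
    using assms(2) by (cases a) auto
qed

text \<open>\<open>A j\<close> is the accumulator after \<open>j\<close> rounds. The registers
  \<open>d1\<close> and \<open>d2\<close> are separate variables so that the rule matches concrete
  numerals.\<close>

lemma evals_Fold:
  assumes init: "evals q d \<rho> c0 (A 0)" and b: "below d b" "expr_val \<rho> b = N" "N \<le> M" "d + 2 < R"
    and body': "\<And>j. j < N \<Longrightarrow> evals q d2 (\<rho>(d := A j, d1 := j)) c (A (Suc j))"
    and eqs: "d1 = d + 1" "d2 = d + 2"
  shows "evals q d \<rho> (Fold d c0 b c) (A N)"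
  unfolding evals_def
proof (intro allI impI)
  note body = body'[unfolded eqs]
  fix \<sigma> assume \<sigma>: "good \<sigma>" "agree d \<rho> \<sigma>" "qtape \<sigma> = q"
  then obtain \<sigma>1 where 1: "runs c0 \<sigma> \<sigma>1" "good \<sigma>1" "agree (Suc d) (\<rho>(d := A 0)) \<sigma>1" "qtape \<sigma>1 = q"
    "outtape \<sigma>1 = outtape \<sigma>" using init unfolding evals_def by blast
  define I where "I j \<tau> \<longleftrightarrow> good \<tau> \<and> agree (d + 2) (\<rho>(d := A j, d + 1 := j)) \<tau> \<and> qtape \<tau> = q \<and>
    outtape \<tau> = outtape \<sigma>" for j \<tau>
  let ?\<sigma>2 = "set_reg (d + 1) 0 \<sigma>1"
  have 2: "runs (Assign (d + 1) (Num 0)) \<sigma>1 ?\<sigma>2"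
    using runs_Assign[OF 1(2), of "d + 1" "Num 0"] b(4) by simp
  have I0: "I 0 ?\<sigma>2"
    using 1 b(4) good_set_reg[OF 1(2), of "d + 1" 0] agree_set_reg[OF 1(3), of 0]
    by (simp add: I_def)
  have bnd: "val \<tau> b = N \<and> regs \<tau> (d + 1) = j" if "I j \<tau>" for j \<tau>
  proof -
    have "agree d \<rho> \<tau>" using that by (simp add: I_def agree_def)
    thus ?thesis using val_agree[of d \<rho> \<tau> b] b that by (simp add: I_def agree_def)
  qed
  have cond: "good \<tau> \<and> (val \<tau> (Less (Reg (d + 1)) b) \<noteq> 0 \<longleftrightarrow> j < N)" if "I j \<tau>" for j \<tau>
    using that bnd[OF that] by (simp add: I_def)
  have step: "\<exists>\<tau>'. runs (Seq c (Seq (Assign d (Reg (d + 2)))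
      (Assign (d + 1) (Plus (Reg (d + 1)) (Num 1))))) \<tau> \<tau>' \<and> I (Suc j) \<tau>'"
    if j: "j < N" "I j \<tau>" for j \<tau>
  proof -
    from body[OF j(1)] j(2) obtain \<tau>1 where \<tau>1: "runs c \<tau> \<tau>1" "good \<tau>1"
      "agree (Suc (d + 2)) (\<rho>(d := A j, d + 1 := j, d + 2 := A (Suc j))) \<tau>1" "qtape \<tau>1 = q"
      "outtape \<tau>1 = outtape \<sigma>"
      unfolding evals_def I_def by metis
    have r: "regs \<tau>1 (d + 2) = A (Suc j)" "regs \<tau>1 (d + 1) = j" "\<And>r. r < d \<Longrightarrow> regs \<tau>1 r = \<rho> r"
      using \<tau>1(3) by (simp_all add: agree_def)
    let ?\<tau>2 = "set_reg d (A (Suc j)) \<tau>1"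
    let ?\<tau>3 = "set_reg (d + 1) (Suc j) ?\<tau>2"
    have A: "A (Suc j) \<le> M" using r(1) \<tau>1(2) by (metis good_def)
    have 3: "runs (Assign d (Reg (d + 2))) \<tau>1 ?\<tau>2" "good ?\<tau>2"
      using runs_Assign[OF \<tau>1(2), of d "Reg (d + 2)"] r A b(4) good_set_reg[OF \<tau>1(2), of d] by simp_all
    have 4: "runs (Assign (d + 1) (Plus (Reg (d + 1)) (Num 1))) ?\<tau>2 ?\<tau>3" "good ?\<tau>3"
      using runs_Assign[OF 3(2), of "d + 1" "Plus (Reg (d + 1)) (Num 1)"] r j(1) b(3,4)
        good_set_reg[OF 3(2), of "d + 1" "Suc j"] by simp_all
    have "I (Suc j) ?\<tau>3"
      using 4(2) \<tau>1(4,5) r by (auto simp: I_def agree_def less_Suc_eq)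
    thus ?thesis using runs_Seq[OF \<tau>1(1) runs_Seq[OF 3(1) 4(1)]] by blast
  qed
  obtain \<tau> where \<tau>: "runs (While (Less (Reg (d + 1)) b)
       (Seq c (Seq (Assign d (Reg (d + 2))) (Assign (d + 1) (Plus (Reg (d + 1)) (Num 1)))))) ?\<sigma>2 \<tau>" "I N \<tau>"
    using runs_While[of I, OF I0 cond step] by auto
  hence "agree (Suc d) (\<rho>(d := A N)) \<tau>" by (auto simp: I_def agree_def)
  thus "\<exists>\<tau>. runs (Fold d c0 b c) \<sigma> \<tau> \<and> good \<tau> \<and>
      agree (Suc d) (\<rho>(d := A N)) \<tau> \<and> qtape \<tau> = q \<and> outtape \<tau> = outtape \<sigma>"
    using \<tau> runs_Seq[OF 1(1) runs_Seq[OF 2 \<tau>(1)]] by (auto simp: I_def Fold_def)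
qed

text \<open>The body is specified for every accumulator value \<open>a\<close>, so its correctness
  does not refer to the indices already tested.\<close>

lemma evals_All:
  assumes "below d b" "expr_val \<rho> b = N" "N \<le> M" "1 \<le> M" "d + 2 < R"
    and body: "\<And>j a. j < N \<Longrightarrow> evals q d2 (\<rho>(d := a, d1 := j)) c (of_bool (P j))"
    and v: "v \<longleftrightarrow> (\<forall>j<N. P j)" and eqs: "d1 = d + 1" "d2 = d + 2"
  shows "evals q d \<rho> (All d b c) (of_bool v)"
proof -
  have "evals q d \<rho> (All d b c) (of_bool (\<forall>j<N. P j))"
    unfolding All_def
  proof (rule evals_Fold[where A = "\<lambda>j. of_bool (\<forall>i<j. P i)", OF _ _ _ _ _ _ refl refl])
    fix j assume "j < N"
    from body[unfolded eqs, OF this, of "of_bool (\<forall>i<j. P i)"] assms(4,5)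
    show "evals q (d + 2) (\<rho>(d := of_bool (\<forall>i<j. P i), d + 1 := j))
        (Seq c (If (Reg (d + 2)) (Assign (d + 2) (Reg d)) (Assign (d + 2) (Num 0))))
        (of_bool (\<forall>i<Suc j. P i))"
      by (intro evals_Cond[where u = "of_bool (P j)"])
        (auto intro!: evals_Assign simp: less_Suc_eq)
  qed (use assms in \<open>auto intro!: evals_Assign\<close>)
  thus ?thesis using v by simp
qed

text \<open>After \<open>j\<close> rounds the query tape holds \<open>take j z\<close>, hence the
  body has to work for every tape content \<open>q\<close>.\<close>

lemma evals_Ask:
  assumes b: "below d b" "expr_val \<rho> b = length z" "length z \<le> M" "1 \<le> M" "d + 1 < R"
    and body': "\<And>j q. j < length z \<Longrightarrow> evals q d1 (\<rho>(d := j)) c (of_bool (z ! j))"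
    and eqs: "d1 = d + 1"
  shows "evals [] d \<rho> (Ask d b c) (of_bool (answer E z))"
  unfolding evals_def
proof (intro allI impI)
  note body = body'[unfolded eqs]
  fix \<sigma> assume \<sigma>: "good \<sigma>" "agree d \<rho> \<sigma>" "qtape \<sigma> = []"
  define I where "I j \<tau> \<longleftrightarrow> good \<tau> \<and> agree (Suc d) (\<rho>(d := j)) \<tau> \<and> qtape \<tau> = take j z \<and>
    outtape \<tau> = outtape \<sigma>" for j \<tau>
  let ?\<sigma>1 = "set_reg d 0 \<sigma>"
  have 1: "runs (Assign d (Num 0)) \<sigma> ?\<sigma>1"
    using runs_Assign[OF \<sigma>(1), of d "Num 0"] b(5) by simp
  have I0: "I 0 ?\<sigma>1"
    using \<sigma> b(5) good_set_reg[OF \<sigma>(1), of d 0] agree_set_reg[OF \<sigma>(2), of 0] by (simp add: I_def)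
  have bnd: "val \<tau> b = length z \<and> regs \<tau> d = j" if "I j \<tau>" for j \<tau>
  proof -
    have "agree d \<rho> \<tau>" using that by (simp add: I_def agree_def)
    thus ?thesis using val_agree[of d \<rho> \<tau> b] b that by (simp add: I_def agree_def)
  qed
  have cond: "good \<tau> \<and> (val \<tau> (Less (Reg d) b) \<noteq> 0 \<longleftrightarrow> j < length z)" if "I j \<tau>" for j \<tau>
    using that bnd[OF that] by (simp add: I_def)
  have step: "\<exists>\<tau>'. runs (Seq c (Seq (PutQuery (Reg (d + 1))) (Assign d (Plus (Reg d) (Num 1))))) \<tau> \<tau>' \<and>
      I (Suc j) \<tau>'" if j: "j < length z" "I j \<tau>" for j \<tau>
  proof -
    from body[OF j(1), of "take j z"] j(2) obtain \<tau>1 where \<tau>1: "runs c \<tau> \<tau>1" "good \<tau>1"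
      "agree (Suc (d + 1)) (\<rho>(d := j, d + 1 := of_bool (z ! j))) \<tau>1" "qtape \<tau>1 = take j z"
      "outtape \<tau>1 = outtape \<sigma>"
      unfolding evals_def I_def by (metis Suc_eq_plus1)
    have r: "regs \<tau>1 (d + 1) = of_bool (z ! j)" "regs \<tau>1 d = j" "\<And>r. r < d \<Longrightarrow> regs \<tau>1 r = \<rho> r"
      using \<tau>1(3) by (simp_all add: agree_def)
    let ?\<tau>2 = "put_query (z ! j) \<tau>1"
    let ?\<tau>3 = "set_reg d (Suc j) ?\<tau>2"
    have 2: "runs (PutQuery (Reg (d + 1))) \<tau>1 ?\<tau>2" "good ?\<tau>2"
      using runs_PutQuery[OF \<tau>1(2), of "Reg (d + 1)"] r good_cong[OF \<tau>1(2)] by (simp_all add: put_query_def)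
    have 3: "runs (Assign d (Plus (Reg d) (Num 1))) ?\<tau>2 ?\<tau>3" "good ?\<tau>3"
      using runs_Assign[OF 2(2), of d "Plus (Reg d) (Num 1)"] r j(1) b(3,5)
        good_set_reg[OF 2(2), of d "Suc j"] by (simp_all add: put_query_def)
    have "I (Suc j) ?\<tau>3"
      using 3(2) \<tau>1(4,5) r j(1)
      by (auto simp: I_def agree_def less_Suc_eq put_query_def take_Suc_conv_app_nth)
    thus ?thesis using runs_Seq[OF \<tau>1(1) runs_Seq[OF 2(1) 3(1)]] by blast
  qed
  obtain \<tau> where \<tau>: "runs (While (Less (Reg d) b)
      (Seq c (Seq (PutQuery (Reg (d + 1))) (Assign d (Plus (Reg d) (Num 1)))))) ?\<sigma>1 \<tau>" "I (length z) \<tau>"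
    using runs_While[of I, OF I0 cond step] by auto
  define \<tau>' where "\<tau>' = (set_reg d (of_bool (answer E z)) \<tau>)\<lparr>qtape := []\<rparr>"
  have g: "good \<tau>'"
    using \<tau>(2) good_set_reg[of \<tau> d "of_bool (answer E z)"] b(4,5)
    by (auto simp: I_def \<tau>'_def good_def)
  have "runs (AskQuery d) \<tau> \<tau>'"
    using exec.AskQuery[of \<tau>' d E \<tau>] \<tau>(2) space_of_good'[OF g] space_of_good'[of \<tau>]
    unfolding runs_def by (metis I_def \<tau>'_def max.boundedI order.refl take_all_iff)
  moreover have "agree (Suc d) (\<rho>(d := of_bool (answer E z))) \<tau>'"
    using \<tau>(2) by (auto simp: I_def agree_def \<tau>'_def)
  ultimately show "\<exists>\<tau>. runs (Ask d b c) \<sigma> \<tau> \<and> good \<tau> \<and>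
      agree (Suc d) (\<rho>(d := of_bool (answer E z))) \<tau> \<and> qtape \<tau> = [] \<and> outtape \<tau> = outtape \<sigma>"
    using \<tau> g runs_Seq[OF 1(1) runs_Seq[OF \<tau>(1), of "AskQuery d" \<tau>']]
    by (intro exI[of _ \<tau>']) (auto simp: I_def Ask_def \<tau>'_def)
qed

lemma runs_Emit:
  assumes b: "below d b" "expr_val \<rho> b = length z" "length z \<le> M" "d + 1 < R"
    and body': "\<And>j q. j < length z \<Longrightarrow> evals q d1 (\<rho>(d := j)) c (of_bool (z ! j))"
    and eqs: "d1 = d + 1" and \<sigma>: "good \<sigma>" "agree d \<rho> \<sigma>"
  shows "\<exists>\<tau>. runs (Emit d b c) \<sigma> \<tau> \<and> outtape \<tau> = outtape \<sigma> @ z"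
proof -
  note body = body'[unfolded eqs]
  define I where "I j \<tau> \<longleftrightarrow> good \<tau> \<and> agree (Suc d) (\<rho>(d := j)) \<tau> \<and> outtape \<tau> = outtape \<sigma> @ take j z"
    for j \<tau>
  let ?\<sigma>1 = "set_reg d 0 \<sigma>"
  have 1: "runs (Assign d (Num 0)) \<sigma> ?\<sigma>1"
    using runs_Assign[OF \<sigma>(1), of d "Num 0"] b(4) by simp
  have I0: "I 0 ?\<sigma>1"
    using \<sigma> b(4) good_set_reg[OF \<sigma>(1), of d 0] agree_set_reg[OF \<sigma>(2), of 0] by (simp add: I_def)
  have bnd: "val \<tau> b = length z \<and> regs \<tau> d = j" if "I j \<tau>" for j \<tau>
  proof -
    have "agree d \<rho> \<tau>" using that by (simp add: I_def agree_def)
    thus ?thesis using val_agree[of d \<rho> \<tau> b] b that by (simp add: I_def agree_def)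
  qed
  have cond: "good \<tau> \<and> (val \<tau> (Less (Reg d) b) \<noteq> 0 \<longleftrightarrow> j < length z)" if "I j \<tau>" for j \<tau>
    using that bnd[OF that] by (simp add: I_def)
  have step: "\<exists>\<tau>'. runs (Seq c (Seq (PutOutput (Reg (d + 1))) (Assign d (Plus (Reg d) (Num 1))))) \<tau> \<tau>' \<and>
      I (Suc j) \<tau>'" if j: "j < length z" "I j \<tau>" for j \<tau>
  proof -
    from body[OF j(1), of "qtape \<tau>"] j(2) obtain \<tau>1 where \<tau>1: "runs c \<tau> \<tau>1" "good \<tau>1"
      "agree (Suc (d + 1)) (\<rho>(d := j, d + 1 := of_bool (z ! j))) \<tau>1"
      "outtape \<tau>1 = outtape \<sigma> @ take j z"
      unfolding evals_def I_def by (metis Suc_eq_plus1)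
    have r: "regs \<tau>1 (d + 1) = of_bool (z ! j)" "regs \<tau>1 d = j" "\<And>r. r < d \<Longrightarrow> regs \<tau>1 r = \<rho> r"
      using \<tau>1(3) by (simp_all add: agree_def)
    let ?\<tau>2 = "put_output (z ! j) \<tau>1"
    let ?\<tau>3 = "set_reg d (Suc j) ?\<tau>2"
    have 2: "runs (PutOutput (Reg (d + 1))) \<tau>1 ?\<tau>2" "good ?\<tau>2"
      using runs_PutOutput[OF \<tau>1(2), of "Reg (d + 1)"] r good_cong[OF \<tau>1(2)] by (simp_all add: put_output_def)
    have 3: "runs (Assign d (Plus (Reg d) (Num 1))) ?\<tau>2 ?\<tau>3" "good ?\<tau>3"
      using runs_Assign[OF 2(2), of d "Plus (Reg d) (Num 1)"] r j(1) b(3,4)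
        good_set_reg[OF 2(2), of d "Suc j"] by (simp_all add: put_output_def)
    have "I (Suc j) ?\<tau>3"
      using 3(2) \<tau>1(4) r j(1)
      by (auto simp: I_def agree_def less_Suc_eq put_output_def take_Suc_conv_app_nth)
    thus ?thesis using runs_Seq[OF \<tau>1(1) runs_Seq[OF 2(1) 3(1)]] by blast
  qed
  obtain \<tau> where \<tau>: "runs (While (Less (Reg d) b)
      (Seq c (Seq (PutOutput (Reg (d + 1))) (Assign d (Plus (Reg d) (Num 1)))))) ?\<sigma>1 \<tau>" "I (length z) \<tau>"
    using runs_While[of I, OF I0 cond step] by auto
  thus ?thesis using runs_Seq[OF 1 \<tau>(1)] by (auto simp: I_def Emit_def)
qed

end

section \<open>Comparing sums of long fractions with a short carry\<close>

context
  fixes f :: "nat \<Rightarrow> int" and deg :: "nat \<Rightarrow> nat" and T c :: nat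
  assumes f_bound: "\<And>t. \<bar>f t\<bar> \<le> int c"
begin

text \<open>The number whose sign is sought is the sum of \<open>f t * 2 ^ deg t\<close> over
  \<open>t < T\<close>; \<open>part j T\<close> collects its coefficients of weight
  \<open>2 ^ j\<close>.\<close>

definition part :: "nat \<Rightarrow> nat \<Rightarrow> int" where
  "part j t = (\<Sum>t'<t. if deg t' = j then f t' else 0)"

fun carry :: "nat \<Rightarrow> int" where
  "carry 0 = 0"
| "carry (Suc j) = (carry j + part j T) div 2"

text \<open>Coefficients of weight \<open>2 ^ j\<close> contribute multiples of
  \<open>2 ^ j\<close>, so they may be added after the floor division; iterated halving is division
  by \<open>2 ^ j\<close>.\<close>

lemma carry_eq: "carry j = (\<Sum>t<T. if deg t < j then f t * 2 ^ deg t else 0) div 2 ^ j"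
proof (induction j)
  case (Suc j)
  let ?V = "\<lambda>j. \<Sum>t<T. if deg t < j then f t * 2 ^ deg t else 0"
  have "?V (Suc j) = ?V j + part j T * 2 ^ j"
    unfolding part_def sum_distrib_right sum.distrib[symmetric]
    by (intro sum.cong) (auto simp: less_Suc_eq)
  hence "?V (Suc j) div 2 ^ Suc j = (?V j + part j T * 2 ^ j) div 2 ^ j div 2"
    using zdiv_zmult2_eq[of 2 "?V j + part j T * 2 ^ j" "2 ^ j"] by (simp add: mult.commute)
  also have "\<dots> = (?V j div 2 ^ j + part j T) div 2" by simp
  finally show ?case using Suc.IH by simp
qed simp

lemma part_bound: "\<bar>part j t\<bar> \<le> int (c * t)"
proof -
  have "\<bar>part j t\<bar> \<le> (\<Sum>t'<t. int c)"
    unfolding part_def by (intro order_trans[OF sum_abs] sum_mono) (use f_bound in auto)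
  thus ?thesis by (simp add: mult.commute)
qed

text \<open>Half of a carry plus a part, each at most \<open>c * T\<close> in absolute value, is
  again at most \<open>c * T\<close>. The bound does not grow with the number of weights.\<close>

lemma carry_bound: "\<bar>carry j\<bar> \<le> int (c * T)"
proof (induction j)
  case (Suc j)
  with part_bound[of j T] show ?case by simp
qed simp

text \<open>Offsets keep the signed carry and its partial updates in the natural numbers.\<close>

definition shifted_carry :: "nat \<Rightarrow> nat" where
  "shifted_carry j = nat (int (c * T) + carry j)"

definition shifted_part :: "nat \<Rightarrow> nat \<Rightarrow> nat" where
  "shifted_part j t = nat (2 * int (c * T) + carry j + part j t)"

lemma shifted_carry_0: "shifted_carry 0 = c * T"
  by (simp add: shifted_carry_def del: of_nat_mult)

lemma shifted_part_0: "shifted_part j 0 = shifted_carry j + c * T"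
  using carry_bound[of j] by (simp add: shifted_carry_def shifted_part_def part_def del: of_nat_mult)

lemma int_shifted_part: "t \<le> T \<Longrightarrow> int (shifted_part j t) = 2 * int (c * T) + carry j + part j t"
  using carry_bound[of j] part_bound[of j t] mult_le_mono2[of t T c]
  unfolding shifted_part_def by linarith

lemma shifted_part_Suc:
  "t < T \<Longrightarrow> int (shifted_part j (Suc t)) = int (shifted_part j t) + (if deg t = j then f t else 0)"
  using int_shifted_part[of "Suc t" j] int_shifted_part[of t j] by (simp add: part_def)

text \<open>Before each update at least \<open>c\<close> is left, so subtracting one coefficient is
  exact in the natural numbers.\<close>

lemma shifted_part_ge: "t < T \<Longrightarrow> c \<le> shifted_part j t"
  using int_shifted_part[of t j] carry_bound[of j] part_bound[of j t] mult_le_mono2[of "Suc t" T c]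
  by (simp del: of_nat_mult)

lemma shifted_part_le: "t \<le> T \<Longrightarrow> shifted_part j t \<le> 4 * (c * T)"
  using int_shifted_part[of t j] carry_bound[of j] part_bound[of j t] mult_le_mono2[of t T c]
  by linarith

text \<open>Halving turns the offset \<open>2 * (c * T)\<close> of \<open>shifted_part\<close> into
  the offset \<open>c * T\<close> of the next carry.\<close>

lemma shifted_carry_Suc: "shifted_carry (Suc j) = shifted_part j T div 2"
proof -
  have "int (shifted_part j T div 2) = int (c * T) + carry (Suc j)"
    using int_shifted_part[of T j] by (simp add: zdiv_int)
  thus ?thesis by (simp add: shifted_carry_def)
qed

lemma shifted_carry_le: "shifted_carry j \<le> 2 * (c * T)"
  using carry_bound[of j] by (simp add: shifted_carry_def del: of_nat_mult)

text \<open>Once all weights are processed, the carry is the whole sum divided by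
  \<open>2 ^ J\<close> and rounded down, which keeps the distinction between negative and
  nonnegative.\<close>

lemma shifted_carry_final:
  assumes "\<And>t. t < T \<Longrightarrow> deg t < J"
  shows "c * T \<le> shifted_carry J \<longleftrightarrow> 0 \<le> (\<Sum>t<T. f t * 2 ^ deg t)"
proof -
  have "(\<Sum>t<T. if deg t < J then f t * 2 ^ deg t else 0) = (\<Sum>t<T. f t * 2 ^ deg t)"
    using assms by (intro sum.cong) auto
  hence "carry J = (\<Sum>t<T. f t * 2 ^ deg t) div 2 ^ J" by (simp add: carry_eq)
  hence "0 \<le> carry J \<longleftrightarrow> 0 \<le> (\<Sum>t<T. f t * 2 ^ deg t)" by (simp add: pos_imp_zdiv_nonneg_iff)
  thus ?thesis using carry_bound[of J] by (simp add: shifted_carry_def nat_le_eq_zle le_nat_iff)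
qed

end

section \<open>Fractions as strings of digits\<close>

definition num_part :: "rat \<Rightarrow> nat" where
  "num_part q = nat \<bar>fst (quotient_of q)\<bar>"

definition den_part :: "rat \<Rightarrow> nat" where
  "den_part q = nat (snd (quotient_of q))"

definition negative :: "rat \<Rightarrow> bool" where
  "negative q \<longleftrightarrow> fst (quotient_of q) < 0"

definition sgn_part :: "rat \<Rightarrow> int" where
  "sgn_part q = (if negative q then -1 else 1)"

lemma rat_digits_alt: "rat_digits l q = negative q # digits l (num_part q) @ digits l (den_part q)"
  by (simp add: rat_digits_def negative_def num_part_def den_part_def split: prod.split)

lemma fits_alt: "fits l q \<longleftrightarrow> num_part q < 2 ^ l \<and> den_part q < 2 ^ l"
  by (simp add: fits_def num_part_def den_part_def split: prod.split)

lemma length_rat_digits [simp]: "length (rat_digits l q) = 1 + 2 * l"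
  by (simp add: rat_digits_alt)

lemma nth_digits [simp]: "j < l \<Longrightarrow> digits l X ! j = bit X j"
  by (simp add: digits_def)

lemma nth_rat_digits:
  "rat_digits l q ! 0 = negative q"
  "j < l \<Longrightarrow> rat_digits l q ! (1 + j) = bit (num_part q) j"
  "j < l \<Longrightarrow> rat_digits l q ! (1 + l + j) = bit (den_part q) j"
  by (simp_all add: rat_digits_alt nth_append)

lemma den_part_pos: "0 < den_part q"
  using quotient_of_denom_pos'[of q] by (simp add: den_part_def)

lemma rat_eq_parts: "q = of_int (sgn_part q) * of_nat (num_part q) / of_nat (den_part q)"
proof -
  have "q = of_int (fst (quotient_of q)) / of_int (snd (quotient_of q))"
    by (rule quotient_of_div) simp
  moreover have "of_int (fst (quotient_of q)) = (of_int (sgn_part q) * of_nat (num_part q) :: rat)"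
    by (simp add: sgn_part_def negative_def num_part_def)
  moreover have "of_int (snd (quotient_of q)) = (of_nat (den_part q) :: rat)"
    using quotient_of_denom_pos'[of q] by (simp add: den_part_def)
  ultimately show ?thesis by metis
qed

lemma digits_inject:
  assumes "X < 2 ^ l" "Y < 2 ^ l" "digits l X = digits l Y"
  shows "X = Y"
proof -
  have "bit X j = bit Y j" if "j < l" for j using assms(3) that by (metis nth_digits)
  hence "take_bit l X = take_bit l Y" by (auto simp: bit_eq_iff bit_take_bit_iff)
  thus ?thesis using assms by (simp add: take_bit_nat_eq_self)
qed

lemma rat_digits_inject:
  assumes "fits l p" "fits l q" "rat_digits l p = rat_digits l q"
  shows "p = q"
proof -
  from assms(3) have "negative p = negative q" "digits l (num_part p) = digits l (num_part q)"
    "digits l (den_part p) = digits l (den_part q)" by (simp_all add: rat_digits_alt)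
  hence "sgn_part p = sgn_part q" "num_part p = num_part q" "den_part p = den_part q"
    using assms(1,2) by (auto simp: fits_alt sgn_part_def intro: digits_inject)
  thus ?thesis using rat_eq_parts[of p] rat_eq_parts[of q] by simp
qed

lemma fits_pos: "fits l q \<Longrightarrow> 0 < l"
  using den_part_pos[of q] by (cases l) (auto simp: fits_alt)

lemma fits_of_bool: "0 < l \<Longrightarrow> fits l (of_bool b)"
  by (auto simp: fits_def)

text \<open>The fractions are 0/1 and 1/1: the lowest digit of the denominator, at position
  \<open>1 + l\<close>, is always set, and the lowest digit of the numerator, at position 1, is set
  for 1.\<close>

lemma nth_rat_digits_of_bool:
  assumes "0 < l" "k < 1 + 2 * l"
  shows "rat_digits l (of_bool b) ! k \<longleftrightarrow> k = 1 + l \<or> k = 1 \<and> b"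
proof -
  have "digits l 1 ! j \<longleftrightarrow> j = 0" "digits l 0 ! j \<longleftrightarrow> False" if "j < l" for j
    using that by (auto simp: bit_1_iff simp del: One_nat_def)
  moreover have "negative (of_bool b) = False" "num_part (of_bool b) = of_bool b" "den_part (of_bool b) = 1"
    by (cases b; simp add: negative_def num_part_def den_part_def)+
  ultimately show ?thesis using assms
    by (cases b) (auto simp: rat_digits_alt nth_append nth_Cons' simp del: nth_digits)
qed

section \<open>Products of numbers as sums over digit positions\<close>

lemma sum_digits:
  assumes "X < 2 ^ l"
  shows "(\<Sum>j<l. of_bool (bit X j) * 2 ^ j) = int X"
proof -
  have "(\<Sum>j<l. of_bool (bit X j) * 2 ^ j) = take_bit l X"
    by (simp add: take_bit_sum push_bit_eq_mult lessThan_atLeast0)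
  also have "\<dots> = X" using assms by (simp add: take_bit_nat_eq_self)
  finally have "int (\<Sum>j<l. of_bool (bit X j) * 2 ^ j) = int X" by simp
  thus ?thesis by simp
qed

text \<open>The map from \<open>t\<close> to \<open>t mod l\<close> and \<open>t div l\<close> is a
  bijection from the numbers below \<open>m * l\<close> to pairs, so the sum factors.\<close>

lemma sum_mod_div:
  fixes a g :: "nat \<Rightarrow> int"
  shows "(\<Sum>t<m * l. a (t mod l) * g (t div l)) = (\<Sum>j<l. a j) * (\<Sum>i<m. g i)"
proof -
  have "(\<Sum>t<m * l. a (t mod l) * g (t div l)) = (\<Sum>i<m. \<Sum>t = i * l..<i * l + l. a (t mod l) * g (t div l))"
    by (rule sum.nat_group[symmetric])
  also have "\<dots> = (\<Sum>i<m. \<Sum>j<l. a j * g i)"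
  proof (rule sum.cong[OF refl])
    fix i
    have "(\<Sum>t = i * l..<i * l + l. a (t mod l) * g (t div l)) = (\<Sum>j = 0..<l. a ((j + i * l) mod l) * g ((j + i * l) div l))"
      using sum.shift_bounds_nat_ivl[of "\<lambda>t. a (t mod l) * g (t div l)" 0 "i * l" l]
      by (simp add: add.commute del: mod_mult_self1 mod_mult_self2 mod_mult_self3 mod_mult_self4)
    also have "\<dots> = (\<Sum>j<l. a j * g i)" by (intro sum.cong) auto
    finally show "(\<Sum>t = i * l..<i * l + l. a (t mod l) * g (t div l)) = (\<Sum>j<l. a j * g i)" .
  qed
  also have "\<dots> = (\<Sum>j<l. a j) * (\<Sum>i<m. g i)"
    by (simp add: sum_distrib_right[symmetric] sum_distrib_left[symmetric])
  finally show ?thesis .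
qed

text \<open>A number \<open>t < l ^ 4\<close> encodes the four digit positions \<open>t mod l\<close>, \<open>t div l mod l\<close>,
  \<open>t div l div l mod l\<close> and \<open>t div l div l div l\<close>.\<close>

lemma sum_four_digits:
  fixes a b c d :: "nat \<Rightarrow> int"
  shows "(\<Sum>t<l ^ 4. a (t mod l) * b (t div l mod l) * c (t div l div l mod l) * d (t div l div l div l)) =
    (\<Sum>j<l. a j) * (\<Sum>j<l. b j) * (\<Sum>j<l. c j) * (\<Sum>j<l. d j)"
proof -
  have "l ^ 4 = (l * l * l) * l" by (simp add: power4_eq_xxxx)
  thus ?thesis
    using sum_mod_div[of a l "\<lambda>t. b (t mod l) * (c (t div l mod l) * d (t div l div l))" "l * l * l"]
      sum_mod_div[of b l "\<lambda>t. c (t mod l) * d (t div l)" "l * l"] sum_mod_div[of c l d l]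
    by (simp add: mult.assoc)
qed

text \<open>The product of the four digits at the positions encoded by \<open>t\<close> has weight
  \<open>2 ^ digit_sum l t\<close>.\<close>

definition digit_sum :: "nat \<Rightarrow> nat \<Rightarrow> nat" where
  "digit_sum l t = t mod l + t div l mod l + t div l div l mod l + t div l div l div l"

lemma digit_sum_less:
  assumes "t < l ^ 4"
  shows "t mod l < l" "t div l mod l < l" "t div l div l mod l < l" "t div l div l div l < l"
    and "digit_sum l t < 4 * l"
proof -
  have "0 < l" using assms by (cases l) auto
  thus *: "t mod l < l" "t div l mod l < l" "t div l div l mod l < l" by simp_all
  have "t < l * (l * l * l)" using assms by (simp add: power4_eq_xxxx mult.assoc)
  thus "t div l div l div l < l"
    by (simp add: div_mult2_eq[symmetric] less_mult_imp_div_less mult.assoc)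
  with * show "digit_sum l t < 4 * l" unfolding digit_sum_def by linarith
qed

text \<open>The coefficients of the numerator of \<open>10 x4 \<plusminus> (2 x1 - x2 - x3)\<close> over the common
  denominator, split into products of single digits.\<close>

definition cross_coeff ::
  "bool \<Rightarrow> rat \<Rightarrow> rat \<Rightarrow> rat \<Rightarrow> rat \<Rightarrow> nat \<Rightarrow> nat \<Rightarrow> nat \<Rightarrow> nat \<Rightarrow> int" where
  "cross_coeff h x1 x2 x3 x4 j1 j2 j3 j4 = (
     let N1 = bit (num_part x1) j1; D1 = bit (den_part x1) j1;
       N2 = bit (num_part x2) j2; D2 = bit (den_part x2) j2;
       N3 = bit (num_part x3) j3; D3 = bit (den_part x3) j3;
       N4 = bit (num_part x4) j4; D4 = bit (den_part x4) j4
     in 10 * of_bool (D1 \<and> D2 \<and> D3 \<and> N4) + (if h then -1 else 1) *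
       (2 * sgn_part x1 * of_bool (N1 \<and> D2 \<and> D3 \<and> D4) -
        sgn_part x2 * of_bool (D1 \<and> N2 \<and> D3 \<and> D4) - sgn_part x3 * of_bool (D1 \<and> D2 \<and> N3 \<and> D4)))"

definition cross_digit :: "nat \<Rightarrow> bool \<Rightarrow> rat \<Rightarrow> rat \<Rightarrow> rat \<Rightarrow> rat \<Rightarrow> nat \<Rightarrow> int" where
  "cross_digit l h x1 x2 x3 x4 t =
     cross_coeff h x1 x2 x3 x4 (t mod l) (t div l mod l) (t div l div l mod l) (t div l div l div l)"

text \<open>The bound is 14 = 10 + 2 + 1 + 1.\<close>

lemma signed_bits_bound:
  fixes e s1 s2 s3 :: int
  assumes "e \<in> {-1, 1}" "s1 \<in> {-1, 1}" "s2 \<in> {-1, 1}" "s3 \<in> {-1, 1}"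
  shows "\<bar>10 * of_bool a + e * (2 * s1 * of_bool b - s2 * of_bool c - s3 * of_bool d)\<bar> \<le> 14"
proof -
  have "\<bar>2 * s1 * of_bool b - s2 * of_bool c - s3 * of_bool d\<bar> \<le> 4"
    using assms(2-4) by (cases b; cases c; cases d) auto
  thus ?thesis using assms(1) by (cases a) auto
qed

lemma cross_digit_bound: "\<bar>cross_digit l h x1 x2 x3 x4 t\<bar> \<le> 14"
  unfolding cross_digit_def cross_coeff_def Let_def
  by (rule signed_bits_bound) (simp_all add: sgn_part_def)

lemma sum_cross_digit:
  assumes "fits l x1" "fits l x2" "fits l x3" "fits l x4"
  shows "(\<Sum>t<l ^ 4. cross_digit l h x1 x2 x3 x4 t * 2 ^ digit_sum l t) =
    10 * (int (den_part x1) * int (den_part x2) * int (den_part x3) * int (num_part x4)) + (if h then -1 else 1) *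
    (2 * sgn_part x1 * (int (num_part x1) * int (den_part x2) * int (den_part x3) * int (den_part x4))
     - sgn_part x2 * (int (den_part x1) * int (num_part x2) * int (den_part x3) * int (den_part x4))
     - sgn_part x3 * (int (den_part x1) * int (den_part x2) * int (num_part x3) * int (den_part x4)))"
proof -
  define V where "V X j = (of_bool (bit X j) * 2 ^ j :: int)" for X :: nat and j
  \<comment> \<open>One digit from each of four numbers, weights included; summed over
    \<open>t\<close> this is the product of the numbers.\<close>
  define W where "W X1 X2 X3 X4 t =
    V X1 (t mod l) * V X2 (t div l mod l) * V X3 (t div l div l mod l) * V X4 (t div l div l div l)"
    for X1 X2 X3 X4 t
  have W: "(\<Sum>t<l ^ 4. W X1 X2 X3 X4 t) = int X1 * int X2 * int X3 * int X4"
    if "X1 < 2 ^ l" "X2 < 2 ^ l" "X3 < 2 ^ l" "X4 < 2 ^ l" for X1 X2 X3 X4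
    unfolding W_def sum_four_digits[where a = "V X1" and b = "V X2" and c = "V X3" and d = "V X4"] unfolding V_def
    by (simp only: sum_digits[OF that(1)] sum_digits[OF that(2)] sum_digits[OF that(3)] sum_digits[OF that(4)])
  have "cross_digit l h x1 x2 x3 x4 t * 2 ^ digit_sum l t =
    10 * W (den_part x1) (den_part x2) (den_part x3) (num_part x4) t + (if h then -1 else 1) *
    (2 * sgn_part x1 * W (num_part x1) (den_part x2) (den_part x3) (den_part x4) t
     - sgn_part x2 * W (den_part x1) (num_part x2) (den_part x3) (den_part x4) t
     - sgn_part x3 * W (den_part x1) (den_part x2) (num_part x3) (den_part x4) t)" for t
    unfolding cross_digit_def cross_coeff_def W_def V_def digit_sum_def Let_def power_add of_bool_conj
    by (simp only: distrib_left right_diff_distrib distrib_right left_diff_distrib ac_simps)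
  thus ?thesis using assms
    by (simp only: sum.distrib sum_subtractf sum_distrib_left[symmetric] W fits_alt)
qed

text \<open>The sum is the difference of the two sides of the inequality times the positive common
  denominator. The coefficients do not contain the sign of \<open>x4\<close>, hence the assumption
  on it.\<close>

lemma sum_cross_digit_nonneg:
  assumes "fits l x1" "fits l x2" "fits l x3" "fits l x4" "0 \<le> x4"
  shows "0 \<le> (\<Sum>t<l ^ 4. cross_digit l h x1 x2 x3 x4 t * 2 ^ digit_sum l t) \<longleftrightarrow>
    (if h then 2 * x1 - x2 - x3 \<le> 10 * x4 else x2 + x3 - 2 * x1 \<le> 10 * x4)"
proof -
  let ?D = "\<lambda>x. of_nat (den_part x) :: rat"
  have D: "0 < ?D x" for x using den_part_pos by simp
  have eq: "of_int (sgn_part x) * of_nat (num_part x) = x * ?D x" for x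
    using rat_eq_parts[of x] D[of x] by (simp add: field_simps)
  have "sgn_part x4 * num_part x4 = num_part x4"
  proof -
    have "0 \<le> fst (quotient_of x4)" using assms(5) by (metis quotient_of_div Fract_of_int_quotient quotient_of_denom_pos zero_le_Fract_iff prod.collapse)
    thus ?thesis by (simp add: sgn_part_def negative_def)
  qed
  hence eq4: "of_nat (num_part x4) = x4 * ?D x4"
    using eq[of x4] by (metis of_int_mult of_int_of_nat_eq)
  have cross: "10 * (d1 * d2 * d3 * (x4 * d4)) + e * (2 * s1 * (n1 * d2 * d3 * d4) - s2 * (d1 * n2 * d3 * d4)
      - s3 * (d1 * d2 * n3 * d4)) = (10 * x4 + e * (2 * x1 - x2 - x3)) * (d1 * d2 * d3 * d4)"
    if s: "s1 * n1 = x1 * d1" "s2 * n2 = x2 * d2" "s3 * n3 = x3 * d3"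
    for d1 d2 d3 d4 n1 n2 n3 s1 s2 s3 e :: rat
  proof -
    have "2 * s1 * (n1 * d2 * d3 * d4) = 2 * (s1 * n1) * (d2 * d3 * d4)"
      "s2 * (d1 * n2 * d3 * d4) = (s2 * n2) * (d1 * d3 * d4)"
      "s3 * (d1 * d2 * n3 * d4) = (s3 * n3) * (d1 * d2 * d4)" by (simp_all only: ac_simps)
    thus ?thesis unfolding s by (simp only: algebra_simps)
  qed
  have "of_int (\<Sum>t<l ^ 4. cross_digit l h x1 x2 x3 x4 t * 2 ^ digit_sum l t) =
    (10 * x4 + (if h then -1 else 1) * (2 * x1 - x2 - x3)) * (?D x1 * ?D x2 * ?D x3 * ?D x4)"
    unfolding sum_cross_digit[OF assms(1-4)]
    using cross[OF eq[of x1] eq[of x2] eq[of x3], of "?D x4" "if h then -1 else 1"]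
    by (simp add: eq4 split del: if_split) (cases h; simp)
  moreover have "0 < ?D x1 * ?D x2 * ?D x3 * ?D x4" using D by simp
  ultimately have "0 \<le> (of_int (\<Sum>t<l ^ 4. cross_digit l h x1 x2 x3 x4 t * 2 ^ digit_sum l t) :: rat) \<longleftrightarrow>
    0 \<le> 10 * x4 + (if h then -1 else 1) * (2 * x1 - x2 - x3)"
    by (simp only: zero_le_mult_iff) auto
  thus ?thesis unfolding of_int_0_le_iff by (cases h) auto
qed

section \<open>The algorithm\<close>

lemma nth_concat_blocks:
  assumes len: "\<And>t. t < N \<Longrightarrow> length (f t) = L" and "t < N" "j < L"
  shows "t * L + j < length (concat (map f [0..<N]))" "concat (map f [0..<N]) ! (t * L + j) = f t ! j"
proof -
  have length: "length (concat (map f [0..<N])) = N * L" if "\<And>t. t < N \<Longrightarrow> length (f t) = L" for N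
    using that by (induction N) simp_all
  have "t * L + j < Suc t * L" using \<open>j < L\<close> by simp
  also have "\<dots> \<le> N * L" using \<open>t < N\<close> by (intro mult_le_mono1) simp
  finally show "t * L + j < length (concat (map f [0..<N]))" using length[OF len] by simp
  show "concat (map f [0..<N]) ! (t * L + j) = f t ! j"
    using len \<open>t < N\<close>
  proof (induction N)
    case (Suc N)
    have l: "length (concat (map f [0..<N])) = N * L" using Suc.prems by (intro length) simp
    show ?case
    proof (cases "t = N")
      case True
      thus ?thesis using l by (simp add: nth_append)
    next
      case False
      hence "t < N" using Suc.prems(2) by simp
      have "t * L + j < Suc t * L" using \<open>j < L\<close> by simp
      also have "\<dots> \<le> N * L" using \<open>t < N\<close> by (intro mult_le_mono1) simp
      finally show ?thesis using l Suc.IH \<open>t < N\<close> Suc.prems(1) by (simp add: nth_append)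
    qed
  qed simp
qed

lemma input_tape_eps:
  assumes "k < 1 + 2 * l"
  shows "input_bit (input_tape n s l \<epsilon> p) k = rat_digits l \<epsilon> ! k"
  using assms by (simp add: input_bit_def input_tape_def nth_append)

text \<open>The tape consists of blocks of length \<open>1 + 2 * l\<close>: block 0 holds
  \<epsilon>, and then each seed has \<open>n + 1\<close> consecutive blocks.\<close>

lemma input_tape_estimate:
  assumes "Y < 2 ^ s" "i \<le> n" "k < 1 + 2 * l"
  shows "input_bit (input_tape n s l \<epsilon> p) ((1 + 2 * l) * (1 + Y * (n + 1) + i) + k) =
    rat_digits l (p (digits s Y) i) ! k"
proof -
  define L where "L = 1 + 2 * l"
  let ?row = "\<lambda>X. concat (map (\<lambda>i. rat_digits l (p (digits s X) i)) [0..<Suc n])"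
  note row = nth_concat_blocks[of "Suc n" "\<lambda>i. rat_digits l (p (digits s Y) i)" L i k]
  have len: "length (?row X) = Suc n * L" for X
    by (simp add: length_concat L_def comp_def sum_list_triv del: upt_Suc)
  have in_row: "i * L + k < Suc n * L" using row(1) assms len[of Y] by (simp add: L_def del: upt_Suc)
  note table = nth_concat_blocks[of "2 ^ s" ?row "Suc n * L" Y "i * L + k", OF len assms(1) in_row]
  have pos: "(1 + 2 * l) * (1 + Y * (n + 1) + i) + k = L + (Y * (Suc n * L) + (i * L + k))"
    by (simp add: L_def algebra_simps)
  have "length (rat_digits l \<epsilon>) = L" by (simp add: L_def)
  thus ?thesis
    unfolding pos input_bit_def input_tape_def
    using table row(2) assms by (simp add: nth_append L_def del: upt_Suc)
qed

text \<open>Registers \<open>0\<close> to \<open>3\<close> hold \<open>n\<close>, \<open>s\<close>, \<open>l\<close> and \<open>2 ^ s\<close>.\<close>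

definition eq_expr :: "expr \<Rightarrow> expr \<Rightarrow> expr" where
  "eq_expr a b = Times (Less a (Plus b (Num 1))) (Less b (Plus a (Num 1)))"

definition tape_pos :: "expr \<Rightarrow> expr \<Rightarrow> expr" where
  "tape_pos t k = Plus (Times (Plus (Num 1) (Times (Num 2) (Reg 2))) t) k"

definition const_bit :: "expr \<Rightarrow> expr \<Rightarrow> expr" where
  "const_bit h k =
     Less (Num 0) (Plus (eq_expr k (Plus (Num 1) (Reg 2))) (Times h (eq_expr k (Num 1))))"

text \<open>A bit of the value given by \<open>estimate\<close>. The fallback value has no place on
  the tape, so its digits are computed, and later code treats both cases alike.\<close>

definition fetch :: "nat \<Rightarrow> expr \<Rightarrow> expr \<Rightarrow> expr \<Rightarrow> expr \<Rightarrow> com" where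
  "fetch d h Y i k = If (Less Y (Reg 3))
     (ReadInput d (tape_pos (Plus (Plus (Num 1) (Times Y (Plus (Reg 0) (Num 1)))) i) k))
     (Assign d (const_bit h k))"

text \<open>The query agrees with the output on seed \<open>X\<close> up to position \<open>i\<close> and with the output on
  seed \<open>Z\<close> after it, except that bit \<open>i\<close> is \<open>b\<close> if \<open>b < 2\<close>.\<close>

definition query :: "nat \<Rightarrow> expr \<Rightarrow> expr \<Rightarrow> expr \<Rightarrow> expr \<Rightarrow> com" where
  "query d X i b Z = Ask d (Reg 0)
     (If (Times (eq_expr (Reg d) i) (Less b (Num 2))) (Assign (d + 1) b)
       (If (Less i (Reg d)) (CallBit (d + 1) Z (Reg d)) (CallBit (d + 1) X (Reg d))))"

definition eq_bits :: "expr \<Rightarrow> expr \<Rightarrow> expr" where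
  "eq_bits a b = Mod (Plus (Plus a b) (Num 1)) (Num 2)"

definition neq_bits :: "expr \<Rightarrow> expr \<Rightarrow> expr" where
  "neq_bits a b = Mod (Plus a b) (Num 2)"

text \<open>With equal seeds and third parameter 2 the query is the generator output itself; its
  answer is compared digit by digit with the estimate at position \<open>n\<close>.\<close>

definition last_check :: com where
  "last_check = All 4 (Reg 3) (Then 6 (query 6 (Reg 5) (Num 0) (Num 2) (Reg 5))
     (All 7 (Plus (Num 1) (Times (Num 2) (Reg 2)))
       (Then 9 (fetch 9 (Num 0) (Reg 5) (Reg 0) (Reg 8))
         (Assign 10 (eq_bits (Reg 9) (const_bit (Reg 6) (Reg 8)))))))"

text \<open>In the main check, registers \<open>5\<close>, \<open>7\<close>, \<open>9\<close>, \<open>11\<close>, \<open>13\<close> hold \<open>i\<close>, \<open>X\<close>, \<open>Y0\<close>, \<open>Y1\<close>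
  and the direction \<open>h\<close> of the inequality.\<close>

definition indist_check :: "nat \<Rightarrow> expr \<Rightarrow> com" where
  "indist_check b Y = If (Less Y (Reg 3))
     (All 14 (Reg 3) (Then 16 (query 16 (Reg 7) (Reg 5) (Num b) (Reg 15))
       (Then 17 (query 17 Y (Reg 5) (Num 2) (Reg 15)) (Assign 18 (eq_bits (Reg 16) (Reg 17))))))
     (Assign 14 (Num 1))"

section \<open>Code for one inequality between fractions\<close>

definition tuples :: expr where
  "tuples = Times (Times (Reg 2) (Reg 2)) (Times (Reg 2) (Reg 2))"

text \<open>The offset \<open>c * T\<close> of the shifted carries for \<open>c = 14\<close> and
  \<open>T = l ^ 4\<close>.\<close>

definition offset :: expr where
  "offset = Times (Num 14) tuples"

definition digit_pos :: "nat \<Rightarrow> expr" where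
  "digit_pos a = (let l = Reg 2; t = Reg 17 in
     if a = 1 then Mod t l else if a = 2 then Mod (Div t l) l
     else if a = 3 then Mod (Div (Div t l) l) l else Div (Div (Div t l) l) l)"

definition num_pos :: "nat \<Rightarrow> expr" where
  "num_pos a = Plus (Num 1) (digit_pos a)"

definition den_pos :: "nat \<Rightarrow> expr" where
  "den_pos a = Plus (Plus (Num 1) (Reg 2)) (digit_pos a)"

definition fetch_X :: "nat \<Rightarrow> expr \<Rightarrow> com" where
  "fetch_X d k = fetch d (Reg 13) (Reg 7) (Reg 5) k"

definition fetch_Y :: "nat \<Rightarrow> nat \<Rightarrow> expr \<Rightarrow> com" where
  "fetch_Y d Y k = fetch d (Reg 13) (Reg Y) (Plus (Reg 5) (Num 1)) k"

definition times4 :: "nat \<Rightarrow> nat \<Rightarrow> nat \<Rightarrow> nat \<Rightarrow> expr" where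
  "times4 a b c d = Times (Times (Times (Reg a) (Reg b)) (Reg c)) (Reg d)"

text \<open>Positive contributions are added before negative ones are subtracted, to avoid
  truncation. The sign of a term combined with the direction in register 13 becomes a comparison of
  two bits.\<close>

definition update_expr :: expr where
  "update_expr = Minus
     (Plus (Reg 16) (Plus (Plus (Times (Num 10) (times4 22 24 26 27))
         (Times (Times (Num 2) (times4 21 24 26 28)) (eq_bits (Reg 18) (Reg 13))))
       (Plus (Times (times4 22 23 26 28) (neq_bits (Reg 19) (Reg 13)))
         (Times (times4 22 24 25 28) (neq_bits (Reg 20) (Reg 13))))))
     (Plus (Times (Times (Num 2) (times4 21 24 26 28)) (neq_bits (Reg 18) (Reg 13)))
       (Plus (Times (times4 22 23 26 28) (eq_bits (Reg 19) (Reg 13)))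
         (Times (times4 22 24 25 28) (eq_bits (Reg 20) (Reg 13)))))"

definition cross_update :: com where
  "cross_update =
     Then 18 (fetch_X 18 (Num 0)) (Then 19 (fetch_Y 19 9 (Num 0)) (Then 20 (fetch_Y 20 11 (Num 0))
     (Then 21 (fetch_X 21 (num_pos 1)) (Then 22 (fetch_X 22 (den_pos 1))
     (Then 23 (fetch_Y 23 9 (num_pos 2)) (Then 24 (fetch_Y 24 9 (den_pos 2))
     (Then 25 (fetch_Y 25 11 (num_pos 3)) (Then 26 (fetch_Y 26 11 (den_pos 3))
     (Then 27 (ReadInput 27 (tape_pos (Num 0) (num_pos 4)))
     (Then 28 (ReadInput 28 (tape_pos (Num 0) (den_pos 4)))
     (Assign 29 update_expr)))))))))))"

text \<open>For each weight all \<open>l ^ 4\<close> tuples are scanned anew and those of other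
  weights skipped: time is spent so that only one short carry is stored.\<close>

definition inequality_check :: com where
  "inequality_check = Then 14
     (Fold 14 (Assign 14 offset) (Times (Num 4) (Reg 2))
       (Then 16
         (Fold 16 (Assign 16 (Plus (Reg 14) offset)) tuples
           (If (eq_expr (Plus (Plus (Plus (digit_pos 1) (digit_pos 2)) (digit_pos 3)) (digit_pos 4)) (Reg 15))
             cross_update (Assign 18 (Reg 16))))
         (Assign 17 (Div (Reg 16) (Num 2)))))
     (Assign 15 (Less offset (Plus (Reg 14) (Num 1))))"

definition main_check :: com where
  "main_check = All 4 (Reg 0) (All 6 (Reg 3) (All 8 (Plus (Reg 3) (Num 1))
     (All 10 (Plus (Reg 3) (Num 1)) (All 12 (Num 2)
       (Seq (indist_check 0 (Reg 9)) (If (Reg 14)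
         (Seq (indist_check 1 (Reg 11)) (If (Reg 14) inequality_check (Assign 14 (Num 1))))
         (Assign 14 (Num 1))))))))"

text \<open>The first loop computes \<open>2 ^ s\<close> in register 3. The output is copied from
  block 1 of the tape, the estimate of seed 0 at position 0.\<close>

definition program :: com where
  "program = Seq (Fold 3 (Assign 3 (Num 1)) (Reg 1) (Assign 5 (Times (Num 2) (Reg 3))))
     (Seq (Seq last_check (If (Reg 4) main_check (Assign 4 (Num 0))))
       (If (Reg 4) (Emit 4 (Plus (Num 1) (Times (Num 2) (Reg 2)))
           (ReadInput 5 (tape_pos (Num 1) (Reg 4)))) Skip))"

section \<open>Values of the expressions in the program\<close>

lemma below_mono: "below d e \<Longrightarrow> d \<le> d' \<Longrightarrow> below d' e"
  by (induction e) auto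

lemma expr_val_eq_expr [simp]: "expr_val \<rho> (eq_expr a b) = of_bool (expr_val \<rho> a = expr_val \<rho> b)"
  by (auto simp: eq_expr_def)

lemma below_exprs [simp]:
  "below d (eq_expr a b) \<longleftrightarrow> below d a \<and> below d b"
  "below d (eq_bits a b) \<longleftrightarrow> below d a \<and> below d b"
  "below d (neq_bits a b) \<longleftrightarrow> below d a \<and> below d b"
  "below d (const_bit a b) \<longleftrightarrow> below d a \<and> below d b \<and> 2 < d"
  "below d (tape_pos a b) \<longleftrightarrow> below d a \<and> below d b \<and> 2 < d"
  "below d tuples \<longleftrightarrow> 2 < d" "below d offset \<longleftrightarrow> 2 < d"
  by (auto simp: eq_expr_def eq_bits_def neq_bits_def const_bit_def tape_pos_def tuples_def offset_def)

lemma expr_val_eq_bits [simp]: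
  "expr_val \<rho> a = of_bool x \<Longrightarrow> expr_val \<rho> b = of_bool y \<Longrightarrow>
    expr_val \<rho> (eq_bits a b) = of_bool (x = y)"
  "expr_val \<rho> a = of_bool x \<Longrightarrow> expr_val \<rho> b = of_bool y \<Longrightarrow>
    expr_val \<rho> (neq_bits a b) = of_bool (x \<noteq> y)"
  by (cases x; cases y; simp add: eq_bits_def neq_bits_def)+

text \<open>A finite check over four digit products, three signs and the direction;
  \<open>14 \<le> acc\<close> makes the subtraction exact.\<close>

lemma cross_update_value:
  fixes acc v :: nat
  assumes "14 \<le> acc" and v: "int v = int acc + cross_coeff h x1 x2 x3 x4 j1 j2 j3 j4"
    and N: "N1 = of_bool (bit (num_part x1) j1)" "N2 = of_bool (bit (num_part x2) j2)"
      "N3 = of_bool (bit (num_part x3) j3)" "N4 = of_bool (bit (num_part x4) j4)"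
    and D: "D1 = of_bool (bit (den_part x1) j1)" "D2 = of_bool (bit (den_part x2) j2)"
      "D3 = of_bool (bit (den_part x3) j3)" "D4 = of_bool (bit (den_part x4) j4)"
  shows "acc + (10 * (D1 * D2 * D3 * N4) + 2 * (N1 * D2 * D3 * D4) * of_bool (negative x1 = h) +
      (D1 * N2 * D3 * D4 * of_bool (negative x2 \<noteq> h) + D1 * D2 * N3 * D4 * of_bool (negative x3 \<noteq> h))) -
    (2 * (N1 * D2 * D3 * D4) * of_bool (negative x1 \<noteq> h) +
      (D1 * N2 * D3 * D4 * of_bool (negative x2 = h) + D1 * D2 * N3 * D4 * of_bool (negative x3 = h))) = v"
proof -
  have "acc + (10 * of_bool a + 2 * of_bool b * of_bool (s1 = h) +
      (of_bool c * of_bool (s2 \<noteq> h) + of_bool d * of_bool (s3 \<noteq> h))) -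
    (2 * of_bool b * of_bool (s1 \<noteq> h) + (of_bool c * of_bool (s2 = h) + of_bool d * of_bool (s3 = h))) = v"
    if "int v = int acc + (10 * of_bool a + (if h then -1 else 1) * (2 * (if s1 then -1 else 1) * of_bool b
      - (if s2 then -1 else 1) * of_bool c - (if s3 then -1 else 1) * of_bool d))"
    for a b c d s1 s2 s3
    using that assms(1) by (cases a; cases b; cases c; cases d; cases s1; cases s2; cases s3; cases h; simp)
  from this[OF v[unfolded cross_coeff_def Let_def sgn_part_def]]
  show ?thesis unfolding N D by (simp only: of_bool_conj mult.assoc)
qed

lemma expr_val_update_expr:
  fixes acc v :: nat
  assumes "14 \<le> acc" "int v = int acc + cross_coeff h x1 x2 x3 x4 j1 j2 j3 j4"
    and "\<rho> 16 = acc" and h: "\<rho> 13 = of_bool h" and s: "\<rho> 18 = of_bool (negative x1)"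
      "\<rho> 19 = of_bool (negative x2)" "\<rho> 20 = of_bool (negative x3)"
    and "\<rho> 21 = of_bool (bit (num_part x1) j1)" "\<rho> 22 = of_bool (bit (den_part x1) j1)"
      "\<rho> 23 = of_bool (bit (num_part x2) j2)" "\<rho> 24 = of_bool (bit (den_part x2) j2)"
      "\<rho> 25 = of_bool (bit (num_part x3) j3)" "\<rho> 26 = of_bool (bit (den_part x3) j3)"
      "\<rho> 27 = of_bool (bit (num_part x4) j4)" "\<rho> 28 = of_bool (bit (den_part x4) j4)"
  shows "expr_val \<rho> update_expr = v"
proof -
  have bits: "expr_val \<rho> (eq_bits (Reg r) (Reg 13)) = of_bool (x = h)"
    "expr_val \<rho> (neq_bits (Reg r) (Reg 13)) = of_bool (x \<noteq> h)" if "\<rho> r = of_bool x" for r x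
    using expr_val_eq_bits[of \<rho> "Reg r" x "Reg 13" h] that h by auto
  show ?thesis
    unfolding update_expr_def times4_def expr_val.simps bits[OF s(1)] bits[OF s(2)] bits[OF s(3)] assms(3)
    by (rule cross_update_value[OF assms(1,2,8,10,12,14,9,11,13,15)])
qed

text \<open>The quantifier over the direction is executed as a loop over the register values 0 and
  1.\<close>

lemma all_bool_less_2: "(\<forall>h. P h) \<longleftrightarrow> (\<forall>j<2. P (j = (1::nat)))"
proof (intro iffI allI)
  fix h assume "\<forall>j<2. P (j = (1::nat))"
  from this[rule_format, of "of_bool h"] show "P h" by (cases h) auto
qed auto

text \<open>The bounds on \<open>M\<close> cover the counters of all loops and, with
  \<open>56 = 4 * 14\<close>, the partial sums bounded in \<open>shifted_part_le\<close>. All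
  registers of the program have numbers below 40.\<close>

locale algorithm = hitting_setting n s w "real_of_rat \<epsilon>" H B
  + machine "alg_env n s l \<epsilon> p B G" M R K
  for n s w l :: nat and \<epsilon> :: rat and H :: "bool list \<Rightarrow> bool list" and B :: obp
    and p :: "bool list \<Rightarrow> nat \<Rightarrow> rat" and G :: com and M R K :: nat +
  assumes fits_eps: "fits l \<epsilon>"
    and fits_p: "\<And>x i. x \<in> cube s \<Longrightarrow> i \<le> n \<Longrightarrow> fits l (p x i)"
    and generator: "\<And>X. X < 2 ^ s \<Longrightarrow> \<exists>m\<le>K. generator_runs G n s X (H (digits s X)) m"
    and R: "R = 40"
    and M: "n + 2 \<le> M" "2 ^ s + 2 \<le> M" "2 * l + 2 \<le> M" "56 * l ^ 4 \<le> M"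
begin

section \<open>Correctness of reading, querying and the last-layer check\<close>

definition base :: "(nat \<Rightarrow> nat) \<Rightarrow> bool" where
  "base \<rho> \<longleftrightarrow> \<rho> 0 = n \<and> \<rho> 2 = l \<and> \<rho> 3 = 2 ^ s"

lemma base_upd [simp]: "4 \<le> r \<Longrightarrow> base (\<rho>(r := a)) = base \<rho>"
  by (simp add: base_def)

definition rval :: "bool \<Rightarrow> nat \<Rightarrow> nat \<Rightarrow> rat" where
  "rval h i Y = (if Y < 2 ^ s then p (digits s Y) i else of_bool h)"

lemma less_R [simp]: "r < R \<longleftrightarrow> r < 40"
  by (simp add: R)

lemma l_pos: "0 < l"
  using fits_eps by (rule fits_pos)

lemma expr_val_const_bit:
  assumes "base \<rho>" "expr_val \<rho> h = of_bool b" "expr_val \<rho> k < 1 + 2 * l"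
  shows "expr_val \<rho> (const_bit h k) = of_bool (rat_digits l (of_bool b) ! expr_val \<rho> k)"
  using nth_rat_digits_of_bool[OF l_pos assms(3), of b] assms(1,2) l_pos
  by (auto simp: const_bit_def base_def)

lemma evals_fetch:
  assumes "base \<rho>" "below d h" "below d Y" "below d i" "below d k" "4 \<le> d" "d < R"
    and "expr_val \<rho> h = of_bool b" "expr_val \<rho> Y = y" "expr_val \<rho> i = i'" "expr_val \<rho> k = k'"
    and "i' \<le> n" "k' < 1 + 2 * l"
  shows "evals q d \<rho> (fetch d h Y i k) (of_bool (rat_digits l (rval b i' y) ! k'))"
  unfolding fetch_def
proof (rule evals_If)
  show "evals q d \<rho> (if expr_val \<rho> (Less Y (Reg 3)) \<noteq> 0
      then ReadInput d (tape_pos (Plus (Plus (Num 1) (Times Y (Plus (Reg 0) (Num 1)))) i) k)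
      else Assign d (const_bit h k)) (of_bool (rat_digits l (rval b i' y) ! k'))"
  proof (cases "y < 2 ^ s")
    case True
    hence "evals q d \<rho> (ReadInput d (tape_pos (Plus (Plus (Num 1) (Times Y (Plus (Reg 0) (Num 1)))) i) k))
        (of_bool (rat_digits l (rval b i' y) ! k'))"
      using input_tape_estimate[of y s i' n k' l \<epsilon> p] assms M
      by (intro evals_ReadInput) (auto simp: tape_pos_def base_def alg_env_def rval_def)
    thus ?thesis using True assms(1,9) by (simp add: base_def)
  next
    case False
    hence "evals q d \<rho> (Assign d (const_bit h k)) (of_bool (rat_digits l (rval b i' y) ! k'))"
      using expr_val_const_bit[of \<rho> h b k] assms M
      by (intro evals_Assign) (auto simp: rval_def)
    thus ?thesis using False assms(1,9) by (simp add: base_def)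
  qed
qed (use assms in auto)

text \<open>The string \<open>u\<close> is never stored: each bit taken from a seed is recomputed by
  a call of the generator at the moment it is written.\<close>

lemma evals_query:
  assumes "base \<rho>" "below d X" "below d i" "below d b" "below d Z" "4 \<le> d" "d + 1 < R"
    and "expr_val \<rho> X = x" "expr_val \<rho> i = i'" "expr_val \<rho> b = b'" "expr_val \<rho> Z = z"
    and "x < 2 ^ s" "z < 2 ^ s" "length u = n"
    and u: "\<And>j. j < n \<Longrightarrow> u ! j =
      (if j = i' \<and> b' < 2 then b' = 1 else if i' < j then seed z ! j else seed x ! j)"
  shows "evals [] d \<rho> (query d X i b Z) (of_bool (obp_eval B u))"
proof -
  have upd: "expr_val (\<rho>(d := j)) e = expr_val \<rho> e" if "below d e" for e j
    by (rule expr_val_agree[OF _ that]) simp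
  have call: "evals q (d + 1) (\<rho>(d := j)) (CallBit (d + 1) Y (Reg d)) (of_bool (seed y ! j))"
    if Y: "j < n" "below d Y" "expr_val \<rho> Y = y" "y < 2 ^ s" for q j Y y
  proof -
    obtain m where "m \<le> K" "generator_runs G n s y (seed y) m"
      using generator[OF Y(4)] by (auto simp: seed_def)
    thus ?thesis using Y assms M below_mono[OF Y(2)] upd[OF Y(2)]
      by (intro evals_CallBit[where xs = "seed y" and m = m]) (auto simp: alg_env_def)
  qed
  have "evals [] d \<rho> (query d X i b Z) (of_bool (answer (alg_env n s l \<epsilon> p B G) u))"
    unfolding query_def
  proof (rule evals_Ask[OF _ _ _ _ _ _ refl])
    fix j q assume "j < length u"
    hence j: "j < n" using assms by simp
    let ?c = "If (Less i (Reg d)) (CallBit (d + 1) Z (Reg d)) (CallBit (d + 1) X (Reg d))"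
    have *: "below (Suc d) e" if "below d e" for e using below_mono[OF that] by simp
    have "evals q (d + 1) (\<rho>(d := j)) ?c (of_bool (if i' < j then seed z ! j else seed x ! j))"
      using call[OF j assms(2,8,12)] call[OF j assms(5,11,13)] assms(3,9)
      by (intro evals_If) (auto simp: * upd)
    moreover have "evals q (d + 1) (\<rho>(d := j)) (Assign (d + 1) b) (of_bool (b' = 1))" if "b' < 2"
      using that assms(4,7,10) M by (intro evals_Assign) (auto simp: * upd)
    ultimately show "evals q (d + 1) (\<rho>(d := j)) (If (Times (eq_expr (Reg d) i) (Less b (Num 2)))
        (Assign (d + 1) b) ?c) (of_bool (u ! j))"
      using assms(3,4,9,10) u[OF j] by (intro evals_If) (auto simp: * upd)
  qed (use assms M in \<open>auto simp: base_def\<close>)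
  thus ?thesis using assms by (simp add: alg_env_def cube_def)
qed

lemma fits_rval: "i \<le> n \<Longrightarrow> fits l (rval h i Y)"
  by (simp add: rval_def fits_p fits_of_bool[OF l_pos])

lemma estimate_rval:
  "estimate (\<lambda>X i. real_of_rat (p (digits s X) i)) h i Y = real_of_rat (rval h i Y)"
  by (cases h) (simp_all add: estimate_def rval_def)

lemma evals_last_check:
  assumes "base \<rho>"
  shows "evals [] 4 \<rho> last_check (of_bool (\<forall>X<2 ^ s. p (digits s X) n = of_bool (obp_eval B (seed X))))"
  unfolding last_check_def
proof (rule evals_All[where ?d1.0 = 5 and ?d2.0 = 6])
  fix X a :: nat assume X: "X < 2 ^ s"
  let ?\<rho> = "\<rho>(4 := a, 5 := X)"
  let ?b = "obp_eval B (seed X)"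
  show "evals [] 6 ?\<rho> (Then 6 (query 6 (Reg 5) (Num 0) (Num 2) (Reg 5))
     (All 7 (Plus (Num 1) (Times (Num 2) (Reg 2))) (Then 9 (fetch 9 (Num 0) (Reg 5) (Reg 0) (Reg 8))
         (Assign 10 (eq_bits (Reg 9) (const_bit (Reg 6) (Reg 8)))))))
     (of_bool (p (digits s X) n = of_bool ?b))"
  proof (rule evals_Then[where d' = 7])
    show "evals [] 6 ?\<rho> (query 6 (Reg 5) (Num 0) (Num 2) (Reg 5)) (of_bool ?b)"
      by (rule evals_query[where x = X and z = X and i' = 0 and b' = 2]) (use X assms in auto)
    let ?\<rho>' = "?\<rho>(6 := of_bool ?b)"
    show "evals [] 7 ?\<rho>' (All 7 (Plus (Num 1) (Times (Num 2) (Reg 2)))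
         (Then 9 (fetch 9 (Num 0) (Reg 5) (Reg 0) (Reg 8))
         (Assign 10 (eq_bits (Reg 9) (const_bit (Reg 6) (Reg 8))))))
       (of_bool (p (digits s X) n = of_bool ?b))"
    proof (rule evals_All[where ?d1.0 = 8 and ?d2.0 = 9 and N = "1 + 2 * l"])
      fix k a :: nat assume k: "k < 1 + 2 * l"
      let ?\<rho>k = "?\<rho>'(7 := a, 8 := k)"
      show "evals [] 9 ?\<rho>k (Then 9 (fetch 9 (Num 0) (Reg 5) (Reg 0) (Reg 8))
         (Assign 10 (eq_bits (Reg 9) (const_bit (Reg 6) (Reg 8)))))
         (of_bool (rat_digits l (p (digits s X) n) ! k = rat_digits l (of_bool ?b) ! k))"
      proof (rule evals_Then[where d' = 10])
        \<comment> \<open>The direction \<open>False\<close> matches \<open>Num 0\<close>; for an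
          actual seed the value is the same in both directions.\<close>
        have "evals [] 9 ?\<rho>k (fetch 9 (Num 0) (Reg 5) (Reg 0) (Reg 8)) (of_bool (rat_digits l (rval False n X) ! k))"
          by (rule evals_fetch) (use k assms in \<open>auto simp: base_def\<close>)
        thus "evals [] 9 ?\<rho>k (fetch 9 (Num 0) (Reg 5) (Reg 0) (Reg 8)) (of_bool (rat_digits l (p (digits s X) n) ! k))"
          using X by (simp add: rval_def)
        let ?\<rho>9 = "?\<rho>k(9 := of_bool (rat_digits l (p (digits s X) n) ! k))"
        have "expr_val ?\<rho>9 (const_bit (Reg 6) (Reg 8)) = of_bool (rat_digits l (of_bool ?b) ! k)"
          using expr_val_const_bit[of ?\<rho>9 "Reg 6" ?b "Reg 8"] k assms by simp
        hence "expr_val ?\<rho>9 (eq_bits (Reg 9) (const_bit (Reg 6) (Reg 8))) =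
            of_bool (rat_digits l (p (digits s X) n) ! k = rat_digits l (of_bool ?b) ! k)"
          by (intro expr_val_eq_bits) simp_all
        thus "evals [] 10 ?\<rho>9 (Assign 10 (eq_bits (Reg 9) (const_bit (Reg 6) (Reg 8))))
            (of_bool (rat_digits l (p (digits s X) n) ! k = rat_digits l (of_bool ?b) ! k))"
          using M by (intro evals_Assign) auto
      qed auto
    next
      have "p (digits s X) n = of_bool ?b \<longleftrightarrow> rat_digits l (p (digits s X) n) = rat_digits l (of_bool ?b)"
        using rat_digits_inject[OF fits_p[of "digits s X" n] fits_of_bool[OF l_pos, of ?b]] by auto
      thus "p (digits s X) n = of_bool ?b \<longleftrightarrow> (\<forall>k<1 + 2 * l. rat_digits l (p (digits s X) n) ! k = rat_digits l (of_bool ?b) ! k)"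
        by (auto simp: list_eq_iff_nth_eq)
    qed (use assms M in \<open>auto simp: base_def\<close>)
  qed auto
qed (use assms M in \<open>auto simp: base_def\<close>)

section \<open>Correctness of the comparison of states and of the inequality\<close>

definition slots :: "nat \<Rightarrow> nat \<Rightarrow> nat \<Rightarrow> nat \<Rightarrow> bool \<Rightarrow> (nat \<Rightarrow> nat) \<Rightarrow> bool" where
  "slots i X Y0 Y1 h \<rho> \<longleftrightarrow> base \<rho> \<and> \<rho> 5 = i \<and> \<rho> 7 = X \<and> \<rho> 9 = Y0 \<and> \<rho> 11 = Y1 \<and>
     \<rho> 13 = of_bool h"

lemma slots_upd [simp]: "14 \<le> r \<Longrightarrow> slots i X Y0 Y1 h (\<rho>(r := a)) = slots i X Y0 Y1 h \<rho>"
  by (simp add: slots_def)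

lemma evals_indist_check:
  assumes "base \<rho>" "\<rho> 5 = i" "\<rho> 7 = X" "below 14 e" "expr_val \<rho> e = Y" "i < n" "X < 2 ^ s" "Y < Suc (2 ^ s)"
  shows "evals [] 14 \<rho> (indist_check (of_bool b) e) (of_bool (Y = 2 ^ s \<or> indist i X b Y))"
  unfolding indist_check_def
proof (rule evals_If)
  let ?c = "Then 16 (query 16 (Reg 7) (Reg 5) (Num (of_bool b)) (Reg 15))
       (Then 17 (query 17 e (Reg 5) (Num 2) (Reg 15)) (Assign 18 (eq_bits (Reg 16) (Reg 17))))"
  have "evals [] 14 \<rho> (All 14 (Reg 3) ?c) (of_bool (indist i X b Y))" if Y: "Y < 2 ^ s"
  proof (rule evals_All[where ?d1.0 = 15 and ?d2.0 = 16, OF _ _ _ _ _ _ indist_def])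
    fix Z a :: nat assume Z: "Z < 2 ^ s"
    let ?u = "take i (seed X) @ b # drop (Suc i) (seed Z)"
    let ?v = "take (Suc i) (seed Y) @ drop (Suc i) (seed Z)"
    let ?\<rho> = "\<rho>(14 := a, 15 := Z)"
    have e: "expr_val (\<rho>(14 := a, 15 := Z, 16 := c)) e = Y" for c
      using expr_val_agree[of 14 "\<rho>(14 := a, 15 := Z, 16 := c)" \<rho> e] assms(4,5) by simp
    show "evals [] 16 ?\<rho> ?c (of_bool (obp_eval B ?u = obp_eval B ?v))"
    proof (rule evals_Then[where d' = 17])
      show "evals [] 16 ?\<rho> (query 16 (Reg 7) (Reg 5) (Num (of_bool b)) (Reg 15)) (of_bool (obp_eval B ?u))"
        by (rule evals_query[where x = X and z = Z and i' = i and b' = "of_bool b"])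
          (use assms Z in \<open>auto simp: nth_append nth_Cons'\<close>)
      show "evals [] 17 (?\<rho>(16 := of_bool (obp_eval B ?u))) (Then 17 (query 17 e (Reg 5) (Num 2) (Reg 15))
          (Assign 18 (eq_bits (Reg 16) (Reg 17)))) (of_bool (obp_eval B ?u = obp_eval B ?v))"
      proof (rule evals_Then[where d' = 18])
        show "evals [] 17 (?\<rho>(16 := of_bool (obp_eval B ?u))) (query 17 e (Reg 5) (Num 2) (Reg 15))
            (of_bool (obp_eval B ?v))"
          by (rule evals_query[where x = Y and z = Z and i' = i and b' = 2])
            (use assms Y Z e below_mono[OF assms(4)] in \<open>auto simp: nth_append min_def\<close>)
      qed (use M in \<open>auto intro!: evals_Assign\<close>)
    qed auto
  qed (use assms M in \<open>auto simp: base_def\<close>)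
  \<comment> \<open>Index \<open>2 ^ s\<close> stands for no seed and passes without a
    query.\<close>
  moreover have "evals [] 14 \<rho> (Assign 14 (Num 1)) (of_bool True)"
    using M by (intro evals_Assign) auto
  ultimately show "evals [] 14 \<rho> (if expr_val \<rho> (Less e (Reg 3)) \<noteq> 0 then All 14 (Reg 3) ?c else Assign 14 (Num 1))
      (of_bool (Y = 2 ^ s \<or> indist i X b Y))"
    using assms by (cases "Y = 2 ^ s") (auto simp: base_def)
qed (use assms in auto)

definition step_slots :: "nat \<Rightarrow> nat \<Rightarrow> nat \<Rightarrow> nat \<Rightarrow> bool \<Rightarrow> nat \<Rightarrow> nat \<Rightarrow> (nat \<Rightarrow> nat) \<Rightarrow> bool" where
  "step_slots i X Y0 Y1 h acc t \<rho> \<longleftrightarrow> slots i X Y0 Y1 h \<rho> \<and> i < n \<and> \<rho> 16 = acc \<and> \<rho> 17 = t \<and> t < l ^ 4"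

lemma step_slots_upd [simp]:
  "18 \<le> r \<Longrightarrow> step_slots i X Y0 Y1 h acc t (\<rho>(r := a)) = step_slots i X Y0 Y1 h acc t \<rho>"
  by (simp add: step_slots_def)

lemma expr_val_pos:
  assumes "step_slots i X Y0 Y1 h acc t \<rho>"
  shows "expr_val \<rho> (num_pos 1) = 1 + t mod l" "expr_val \<rho> (den_pos 1) = 1 + l + t mod l"
    "expr_val \<rho> (num_pos 2) = 1 + t div l mod l" "expr_val \<rho> (den_pos 2) = 1 + l + t div l mod l"
    "expr_val \<rho> (num_pos 3) = 1 + t div l div l mod l" "expr_val \<rho> (den_pos 3) = 1 + l + t div l div l mod l"
    "expr_val \<rho> (num_pos 4) = 1 + t div l div l div l" "expr_val \<rho> (den_pos 4) = 1 + l + t div l div l div l"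
  using assms by (auto simp: step_slots_def slots_def base_def num_pos_def den_pos_def digit_pos_def Let_def)

lemma below_pos [simp]: "17 < d \<Longrightarrow> below d (digit_pos a)" "17 < d \<Longrightarrow> below d (num_pos a)"
  "17 < d \<Longrightarrow> below d (den_pos a)"
  by (auto simp: num_pos_def den_pos_def digit_pos_def Let_def)

lemma evals_fetch_X:
  assumes "step_slots i X Y0 Y1 h acc t \<rho>" "18 \<le> d" "d < 40"
  shows "evals q d \<rho> (fetch_X d (Num 0)) (of_bool (negative (rval h i X)))"
    and "evals q d \<rho> (fetch_X d (num_pos 1)) (of_bool (bit (num_part (rval h i X)) (t mod l)))"
    and "evals q d \<rho> (fetch_X d (den_pos 1)) (of_bool (bit (den_part (rval h i X)) (t mod l)))"
proof -
  have f: "evals q d \<rho> (fetch_X d k) (of_bool b)"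
    if "expr_val \<rho> k = k'" "below d k" "k' < 1 + 2 * l" "rat_digits l (rval h i X) ! k' = b" for k k' b
    unfolding fetch_X_def that(4)[symmetric]
    by (rule evals_fetch) (use that(1-3) assms in \<open>auto simp: step_slots_def slots_def\<close>)
  have t: "t mod l < l" using l_pos by simp
  note e = expr_val_pos[OF assms(1)]
  show "evals q d \<rho> (fetch_X d (Num 0)) (of_bool (negative (rval h i X)))"
    by (rule f[of "Num 0" 0]) (simp_all add: nth_rat_digits(1))
  show "evals q d \<rho> (fetch_X d (num_pos 1)) (of_bool (bit (num_part (rval h i X)) (t mod l)))"
    by (rule f[OF e(1) _ _ nth_rat_digits(2)[OF t]]) (use t assms(2) in \<open>(linarith | simp)+\<close>)
  show "evals q d \<rho> (fetch_X d (den_pos 1)) (of_bool (bit (den_part (rval h i X)) (t mod l)))"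
    by (rule f[OF e(2) _ _ nth_rat_digits(3)[OF t]]) (use t assms(2) in \<open>(linarith | simp)+\<close>)
qed

lemma evals_fetch_Y:
  assumes "step_slots i X Y0 Y1 h acc t \<rho>" "18 \<le> d" "d < 40"
  shows "evals q d \<rho> (fetch_Y d 9 (Num 0)) (of_bool (negative (rval h (Suc i) Y0)))"
    and "evals q d \<rho> (fetch_Y d 11 (Num 0)) (of_bool (negative (rval h (Suc i) Y1)))"
    and "evals q d \<rho> (fetch_Y d 9 (num_pos 2)) (of_bool (bit (num_part (rval h (Suc i) Y0)) (t div l mod l)))"
    and "evals q d \<rho> (fetch_Y d 9 (den_pos 2)) (of_bool (bit (den_part (rval h (Suc i) Y0)) (t div l mod l)))"
    and "evals q d \<rho> (fetch_Y d 11 (num_pos 3)) (of_bool (bit (num_part (rval h (Suc i) Y1)) (t div l div l mod l)))"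
    and "evals q d \<rho> (fetch_Y d 11 (den_pos 3)) (of_bool (bit (den_part (rval h (Suc i) Y1)) (t div l div l mod l)))"
proof -
  have f: "evals q d \<rho> (fetch_Y d r k) (of_bool b)"
    if "expr_val \<rho> k = k'" "\<rho> r = Y" "r < d" "below d k" "k' < 1 + 2 * l"
      "rat_digits l (rval h (Suc i) Y) ! k' = b" for k k' r Y b
    unfolding fetch_Y_def that(6)[symmetric]
    by (rule evals_fetch) (use that(1-5) assms in \<open>auto simp: step_slots_def slots_def\<close>)
  have \<rho>: "\<rho> 9 = Y0" "\<rho> 11 = Y1" using assms(1) by (simp_all add: step_slots_def slots_def)
  have t: "t div l mod l < l" "t div l div l mod l < l" using l_pos by simp_all
  note e = expr_val_pos[OF assms(1)]
  show "evals q d \<rho> (fetch_Y d 9 (Num 0)) (of_bool (negative (rval h (Suc i) Y0)))"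
    by (rule f[OF _ \<rho>(1), of "Num 0" 0]) (use assms(2) in \<open>simp_all add: nth_rat_digits(1)\<close>)
  show "evals q d \<rho> (fetch_Y d 11 (Num 0)) (of_bool (negative (rval h (Suc i) Y1)))"
    by (rule f[OF _ \<rho>(2), of "Num 0" 0]) (use assms(2) in \<open>simp_all add: nth_rat_digits(1)\<close>)
  show "evals q d \<rho> (fetch_Y d 9 (num_pos 2)) (of_bool (bit (num_part (rval h (Suc i) Y0)) (t div l mod l)))"
    by (rule f[OF e(3) \<rho>(1) _ _ _ nth_rat_digits(2)[OF t(1)]]) (use t assms(2) in \<open>(linarith | simp)+\<close>)
  show "evals q d \<rho> (fetch_Y d 9 (den_pos 2)) (of_bool (bit (den_part (rval h (Suc i) Y0)) (t div l mod l)))"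
    by (rule f[OF e(4) \<rho>(1) _ _ _ nth_rat_digits(3)[OF t(1)]]) (use t assms(2) in \<open>(linarith | simp)+\<close>)
  show "evals q d \<rho> (fetch_Y d 11 (num_pos 3)) (of_bool (bit (num_part (rval h (Suc i) Y1)) (t div l div l mod l)))"
    by (rule f[OF e(5) \<rho>(2) _ _ _ nth_rat_digits(2)[OF t(2)]]) (use t assms(2) in \<open>(linarith | simp)+\<close>)
  show "evals q d \<rho> (fetch_Y d 11 (den_pos 3)) (of_bool (bit (den_part (rval h (Suc i) Y1)) (t div l div l mod l)))"
    by (rule f[OF e(6) \<rho>(2) _ _ _ nth_rat_digits(3)[OF t(2)]]) (use t assms(2) in \<open>(linarith | simp)+\<close>)
qed

lemma evals_fetch_eps:
  assumes "step_slots i X Y0 Y1 h acc t \<rho>" "18 \<le> d" "d < 40"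
  shows "evals q d \<rho> (ReadInput d (tape_pos (Num 0) (num_pos 4)))
      (of_bool (bit (num_part \<epsilon>) (t div l div l div l)))"
    and "evals q d \<rho> (ReadInput d (tape_pos (Num 0) (den_pos 4)))
      (of_bool (bit (den_part \<epsilon>) (t div l div l div l)))"
proof -
  have f: "evals q d \<rho> (ReadInput d (tape_pos (Num 0) k)) (of_bool b)"
    if "expr_val \<rho> k = k'" "below d k" "k' < 1 + 2 * l" "rat_digits l \<epsilon> ! k' = b" for k k' b
    using that assms M input_tape_eps[OF that(3), of n s \<epsilon> p]
    by (intro evals_ReadInput) (auto simp: tape_pos_def alg_env_def)
  have t: "t div l div l div l < l" using assms(1) by (intro digit_sum_less) (simp add: step_slots_def)
  note e = expr_val_pos[OF assms(1)]
  show "evals q d \<rho> (ReadInput d (tape_pos (Num 0) (num_pos 4)))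
      (of_bool (bit (num_part \<epsilon>) (t div l div l div l)))"
    by (rule f[OF e(7) _ _ nth_rat_digits(2)[OF t]]) (use t assms(2) in \<open>(linarith | simp)+\<close>)
  show "evals q d \<rho> (ReadInput d (tape_pos (Num 0) (den_pos 4)))
      (of_bool (bit (den_part \<epsilon>) (t div l div l div l)))"
    by (rule f[OF e(8) _ _ nth_rat_digits(3)[OF t]]) (use t assms(2) in \<open>(linarith | simp)+\<close>)
qed

lemma evals_cross_update:
  assumes step: "step_slots i X Y0 Y1 h acc t \<rho>" and acc: "14 \<le> acc" and "v \<le> M"
    and v: "int v = int acc + cross_digit l h (rval h i X) (rval h (Suc i) Y0) (rval h (Suc i) Y1) \<epsilon> t"
  shows "evals q 18 \<rho> cross_update v"
  unfolding cross_update_def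
  apply (rule evals_Then[where d' = 19], rule evals_fetch_X(1)[OF step], simp, simp)
  apply (rule evals_Then[where d' = 20], rule evals_fetch_Y(1)[of i X Y0 Y1 h acc t], simp add: step, simp, simp)
  apply (rule evals_Then[where d' = 21], rule evals_fetch_Y(2)[of i X Y0 Y1 h acc t], simp add: step, simp, simp)
  apply (rule evals_Then[where d' = 22], rule evals_fetch_X(2)[of i X Y0 Y1 h acc t], simp add: step, simp, simp)
  apply (rule evals_Then[where d' = 23], rule evals_fetch_X(3)[of i X Y0 Y1 h acc t], simp add: step, simp, simp)
  apply (rule evals_Then[where d' = 24], rule evals_fetch_Y(3)[of i X Y0 Y1 h acc t], simp add: step, simp, simp)
  apply (rule evals_Then[where d' = 25], rule evals_fetch_Y(4)[of i X Y0 Y1 h acc t], simp add: step, simp, simp)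
  apply (rule evals_Then[where d' = 26], rule evals_fetch_Y(5)[of i X Y0 Y1 h acc t], simp add: step, simp, simp)
  apply (rule evals_Then[where d' = 27], rule evals_fetch_Y(6)[of i X Y0 Y1 h acc t], simp add: step, simp, simp)
  apply (rule evals_Then[where d' = 28], rule evals_fetch_eps(1)[of i X Y0 Y1 h acc t], simp add: step, simp, simp)
  apply (rule evals_Then[where d' = 29], rule evals_fetch_eps(2)[of i X Y0 Y1 h acc t], simp add: step, simp, simp)
  apply (rule evals_Assign)
     apply (simp add: update_expr_def times4_def)
    apply simp
   apply (subst expr_val_update_expr[OF acc v[unfolded cross_digit_def]];
      use step \<open>v \<le> M\<close> in \<open>simp add: step_slots_def slots_def\<close>)
  apply (subst expr_val_update_expr[OF acc v[unfolded cross_digit_def]];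
      use step in \<open>simp add: step_slots_def slots_def\<close>)
  apply simp_all
  done

lemma evals_inequality_check:
  assumes slots: "slots i X Y0 Y1 h \<rho>" and i: "i < n"
  defines "x1 \<equiv> rval h i X" and "x2 \<equiv> rval h (Suc i) Y0" and "x3 \<equiv> rval h (Suc i) Y1"
  shows "evals q 14 \<rho> inequality_check
    (of_bool (if h then 2 * x1 - x2 - x3 \<le> 10 * \<epsilon> else x2 + x3 - 2 * x1 \<le> 10 * \<epsilon>))"
proof -
  let ?f = "cross_digit l h x1 x2 x3 \<epsilon>" and ?deg = "digit_sum l" and ?T = "l ^ 4"
  have bound: "\<bar>?f t\<bar> \<le> int 14" for t using cross_digit_bound[of l h x1 x2 x3 \<epsilon> t] by simp
  \<comment> \<open>The loop values: \<open>A j\<close> is the carry entering weight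
    \<open>j\<close>, and \<open>A' j t\<close> the running total within this weight after
    \<open>t\<close> tuples.\<close>
  define A where "A = shifted_carry ?f ?deg ?T 14"
  define A' where "A' = shifted_part ?f ?deg ?T 14"
  note carry_facts = shifted_carry_0[where f = ?f and deg = ?deg and T = ?T, OF bound]
    shifted_carry_Suc[where f = ?f and deg = ?deg and T = ?T, OF bound]
    shifted_part_0[where f = ?f and deg = ?deg and T = ?T, OF bound]
  have lM: "4 * l \<le> M" using M(4) self_le_power[of l 4] l_pos by linarith
  have base: "base \<rho>" using slots by (simp add: slots_def)
  have tuples: "expr_val \<rho>' tuples = l ^ 4" "expr_val \<rho>' offset = 14 * l ^ 4" if "base \<rho>'" for \<rho>'
    using that by (simp_all add: tuples_def offset_def base_def power4_eq_xxxx mult.assoc)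
  have le: "A j \<le> M" "t \<le> ?T \<Longrightarrow> A' j t \<le> M" for j t
    using shifted_carry_le[where f = ?f and deg = ?deg and T = ?T and j = j, OF bound]
      shifted_part_le[where f = ?f and deg = ?deg and T = ?T and j = j and t = t, OF bound] M(4)
    by (simp_all add: A_def A'_def)
  have step: "evals q 18 (\<rho>(14 := A j, 15 := j, 16 := A' j t, 17 := t))
      (If (eq_expr (Plus (Plus (Plus (digit_pos 1) (digit_pos 2)) (digit_pos 3)) (digit_pos 4)) (Reg 15))
         cross_update (Assign 18 (Reg 16))) (A' j (Suc t))" if t: "t < ?T" for j t
  proof (rule evals_If)
    let ?\<rho> = "\<rho>(14 := A j, 15 := j, 16 := A' j t, 17 := t)"
    have next': "int (A' j (Suc t)) = int (A' j t) + (if digit_sum l t = j then ?f t else 0)"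
      unfolding A'_def by (rule shifted_part_Suc[OF bound t])
    have s: "step_slots i X Y0 Y1 h (A' j t) t ?\<rho>"
      using slots i t by (simp add: step_slots_def)
    have ge: "14 \<le> A' j t" unfolding A'_def by (rule shifted_part_ge[OF bound t])
    have "?\<rho> 2 = l" using base by (simp add: base_def)
    hence "expr_val ?\<rho> (eq_expr (Plus (Plus (Plus (digit_pos 1) (digit_pos 2)) (digit_pos 3)) (digit_pos 4)) (Reg 15))
      = of_bool (digit_sum l t = j)"
      by (simp add: digit_pos_def Let_def digit_sum_def)
    moreover have "evals q 18 ?\<rho> cross_update (A' j (Suc t))" if "digit_sum l t = j"
      using evals_cross_update[OF s ge le(2)[of "Suc t" j]] next' t that by (simp add: x1_def x2_def x3_def)
    moreover have "evals q 18 ?\<rho> (Assign 18 (Reg 16)) (A' j (Suc t))" if "digit_sum l t \<noteq> j"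
      using next' that le(2)[of t j] t by (intro evals_Assign) auto
    ultimately show "evals q 18 ?\<rho> (if expr_val ?\<rho> (eq_expr (Plus (Plus (Plus (digit_pos 1) (digit_pos 2))
        (digit_pos 3)) (digit_pos 4)) (Reg 15)) \<noteq> 0 then cross_update else Assign 18 (Reg 16)) (A' j (Suc t))"
      by simp
  qed simp
  have outer: "evals q 16 (\<rho>(14 := A j, 15 := j)) (Then 16
      (Fold 16 (Assign 16 (Plus (Reg 14) offset)) tuples
         (If (eq_expr (Plus (Plus (Plus (digit_pos 1) (digit_pos 2)) (digit_pos 3)) (digit_pos 4)) (Reg 15))
           cross_update (Assign 18 (Reg 16)))) (Assign 17 (Div (Reg 16) (Num 2)))) (A (Suc j))" for j
  proof (rule evals_Then[where d' = 17])
    show "evals q 16 (\<rho>(14 := A j, 15 := j)) (Fold 16 (Assign 16 (Plus (Reg 14) offset)) tuples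
         (If (eq_expr (Plus (Plus (Plus (digit_pos 1) (digit_pos 2)) (digit_pos 3)) (digit_pos 4)) (Reg 15))
           cross_update (Assign 18 (Reg 16)))) (A' j ?T)"
    proof (rule evals_Fold[where A = "A' j" and ?d1.0 = 17 and ?d2.0 = 18])
      show "evals q 16 (\<rho>(14 := A j, 15 := j)) (Assign 16 (Plus (Reg 14) offset)) (A' j 0)"
        using tuples[of "\<rho>(14 := A j, 15 := j)"] base carry_facts(3)[of j] le(2)[of 0 j]
        by (intro evals_Assign) (auto simp: A_def A'_def)
    qed (use step tuples base M(4) in auto)
    show "evals q 17 (\<rho>(14 := A j, 15 := j, 16 := A' j ?T)) (Assign 17 (Div (Reg 16) (Num 2))) (A (Suc j))"
      using carry_facts(2)[of j] le(1)[of "Suc j"] by (intro evals_Assign) (auto simp: A_def A'_def)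
  qed auto
  show ?thesis
    unfolding inequality_check_def
  proof (rule evals_Then[where d' = 15])
    show "evals q 14 \<rho> (Fold 14 (Assign 14 offset) (Times (Num 4) (Reg 2))
       (Then 16 (Fold 16 (Assign 16 (Plus (Reg 14) offset)) tuples
           (If (eq_expr (Plus (Plus (Plus (digit_pos 1) (digit_pos 2)) (digit_pos 3)) (digit_pos 4)) (Reg 15))
             cross_update (Assign 18 (Reg 16))))
         (Assign 17 (Div (Reg 16) (Num 2))))) (A (4 * l))"
    proof (rule evals_Fold[where A = A and ?d1.0 = 15 and ?d2.0 = 16])
      show "evals q 14 \<rho> (Assign 14 offset) (A 0)"
        using tuples[OF base] carry_facts(1) le(1)[of 0] by (intro evals_Assign) (auto simp: A_def)
    qed (use outer base lM in \<open>auto simp: base_def\<close>)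
    \<comment> \<open>The numerator of \<epsilon> enters the sum without its sign.\<close>
    have "0 \<le> \<epsilon>" using eps_pos by simp
    hence "(14 * l ^ 4 \<le> A (4 * l)) = (if h then 2 * x1 - x2 - x3 \<le> 10 * \<epsilon> else x2 + x3 - 2 * x1 \<le> 10 * \<epsilon>)"
      using shifted_carry_final[where f = ?f and deg = ?deg and T = ?T, OF bound digit_sum_less(5)] i
        sum_cross_digit_nonneg[of l x1 x2 x3 \<epsilon> h] fits_rval fits_eps
      by (simp add: A_def x1_def x2_def x3_def)
    thus "evals q 15 (\<rho>(14 := A (4 * l))) (Assign 15 (Less offset (Plus (Reg 14) (Num 1))))
      (of_bool (if h then 2 * x1 - x2 - x3 \<le> 10 * \<epsilon> else x2 + x3 - 2 * x1 \<le> 10 * \<epsilon>))"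
      using tuples(2)[of "\<rho>(14 := A (4 * l))"] base M(1) by (cases h) (auto intro!: evals_Assign)
  qed auto
qed

section \<open>The main check and the whole program\<close>

lemma consistent_at_rval:
  assumes "X < 2 ^ s"
  shows "consistent_at (\<lambda>X i. real_of_rat (p (digits s X) i)) h i X Y0 Y1 \<longleftrightarrow>
    (if h then 2 * rval h i X - rval h (Suc i) Y0 - rval h (Suc i) Y1 \<le> 10 * \<epsilon>
     else rval h (Suc i) Y0 + rval h (Suc i) Y1 - 2 * rval h i X \<le> 10 * \<epsilon>)"
proof -
  have "p (digits s X) i = rval h i X" using assms by (simp add: rval_def)
  hence "consistent_at (\<lambda>X i. real_of_rat (p (digits s X) i)) h i X Y0 Y1 \<longleftrightarrow>
    (if h then real_of_rat (2 * rval h i X - rval h (Suc i) Y0 - rval h (Suc i) Y1) \<le> real_of_rat (10 * \<epsilon>)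
     else real_of_rat (rval h (Suc i) Y0 + rval h (Suc i) Y1 - 2 * rval h i X) \<le> real_of_rat (10 * \<epsilon>))"
    by (simp only: consistent_at_def estimate_rval of_rat_add of_rat_diff of_rat_mult of_rat_numeral_eq)
  thus ?thesis by (simp only: of_rat_less_eq)
qed

lemma evals_main_check:
  assumes base: "base \<rho>"
  shows "evals [] 4 \<rho> main_check (of_bool (\<forall>i<n. \<forall>X<2 ^ s. \<forall>Y0<Suc (2 ^ s). \<forall>Y1<Suc (2 ^ s). \<forall>h.
       (Y0 = 2 ^ s \<or> indist i X False Y0) \<longrightarrow> (Y1 = 2 ^ s \<or> indist i X True Y1) \<longrightarrow>
       consistent_at (\<lambda>X i. real_of_rat (p (digits s X) i)) h i X Y0 Y1))"
proof -
  let ?I0 = "\<lambda>i X Y0. Y0 = 2 ^ s \<or> indist i X False Y0"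
  let ?I1 = "\<lambda>i X Y1. Y1 = 2 ^ s \<or> indist i X True Y1"
  let ?C = "consistent_at (\<lambda>X i. real_of_rat (p (digits s X) i))"
  let ?c = "Seq (indist_check 0 (Reg 9)) (If (Reg 14)
         (Seq (indist_check 1 (Reg 11)) (If (Reg 14) inequality_check (Assign 14 (Num 1))))
         (Assign 14 (Num 1)))"
  have inner: "evals [] 14 \<rho>' ?c (of_bool (?I0 i X Y0 \<longrightarrow> ?I1 i X Y1 \<longrightarrow> ?C h i X Y0 Y1))"
    if slots: "slots i X Y0 Y1 h \<rho>'" and lt: "i < n" "X < 2 ^ s" "Y0 < Suc (2 ^ s)" "Y1 < Suc (2 ^ s)"
    for i X Y0 Y1 h \<rho>'
  proof (intro evals_implies)
    have r: "base \<rho>'" "\<rho>' 5 = i" "\<rho>' 7 = X" "\<rho>' 9 = Y0" "\<rho>' 11 = Y1"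
      using slots by (simp_all add: slots_def)
    show "evals [] 14 \<rho>' (indist_check 0 (Reg 9)) (of_bool (?I0 i X Y0))"
      using evals_indist_check[OF r(1-3) _ _ lt(1-3), of "Reg 9" False] r by simp
    show "evals [] 14 \<rho>' (indist_check 1 (Reg 11)) (of_bool (?I1 i X Y1))"
      using evals_indist_check[OF r(1-3) _ _ lt(1,2,4), of "Reg 11" True] r by simp
    show "evals [] 14 \<rho>' inequality_check (of_bool (?C h i X Y0 Y1))"
      unfolding consistent_at_rval[OF lt(2)] by (rule evals_inequality_check[OF slots lt(1)])
  qed (use M in auto)
  show ?thesis
    unfolding main_check_def
  proof (rule evals_All[where ?d1.0 = 5 and ?d2.0 = 6, OF _ _ _ _ _ _ refl], goal_cases)
    case (6 i a4)
    show ?case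
    proof (rule evals_All[where ?d1.0 = 7 and ?d2.0 = 8, OF _ _ _ _ _ _ refl], goal_cases)
      case (6 X a6)
      show ?case
      proof (rule evals_All[where ?d1.0 = 9 and ?d2.0 = 10, OF _ _ _ _ _ _ refl], goal_cases)
        case (6 Y0 a8)
        show ?case
        proof (rule evals_All[where ?d1.0 = 11 and ?d2.0 = 12, OF _ _ _ _ _ _ refl], goal_cases)
          case (6 Y1 a10)
          let ?\<rho> = "\<rho>(4 := a4, 5 := i, 6 := a6, 7 := X, 8 := a8, 9 := Y0, 10 := a10, 11 := Y1)"
          let ?P = "\<lambda>h. ?I0 i X Y0 \<longrightarrow> ?I1 i X Y1 \<longrightarrow> ?C h i X Y0 Y1"
          show ?case
          proof (rule evals_All[where ?d1.0 = 13 and ?d2.0 = 14 and P = "\<lambda>j. ?P (j = 1)"])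
            fix j a :: nat assume "j < 2"
            hence "slots i X Y0 Y1 (j = 1) (?\<rho>(12 := a, 13 := j))"
              using base by (auto simp: slots_def)
            thus "evals [] 14 (?\<rho>(12 := a, 13 := j)) ?c (of_bool (?P (j = 1)))"
              by (rule inner) fact+
          next
            show "(\<forall>h. ?P h) \<longleftrightarrow> (\<forall>j<2. ?P (j = (1::nat)))"
              by (rule all_bool_less_2)
          qed (use M in auto)
        qed (use base M in \<open>auto simp: base_def\<close>)
      qed (use base M in \<open>auto simp: base_def\<close>)
    qed (use base M in \<open>auto simp: base_def\<close>)
  qed (use base M in \<open>auto simp: base_def\<close>)
qed

abbreviation accepted :: bool where
  "accepted \<equiv> consistent (\<lambda>X i. real_of_rat (p (digits s X) i))"

lemma evals_accept:
  assumes "base \<rho>"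
  shows "evals [] 4 \<rho> (Seq last_check (If (Reg 4) main_check (Assign 4 (Num 0)))) (of_bool accepted)"
proof -
  have "real_of_rat (p (digits s X) n) = of_bool b \<longleftrightarrow> p (digits s X) n = of_bool b" for X b
    by (cases b) auto
  hence "accepted \<longleftrightarrow> (\<forall>X<2 ^ s. p (digits s X) n = of_bool (obp_eval B (seed X))) \<and>
      (\<forall>i<n. \<forall>X<2 ^ s. \<forall>Y0<Suc (2 ^ s). \<forall>Y1<Suc (2 ^ s). \<forall>h.
       (Y0 = 2 ^ s \<or> indist i X False Y0) \<longrightarrow> (Y1 = 2 ^ s \<or> indist i X True Y1) \<longrightarrow>
       consistent_at (\<lambda>X i. real_of_rat (p (digits s X) i)) h i X Y0 Y1)"
    by (simp only: consistent_def)
  thus ?thesis using evals_conj[OF evals_last_check[OF assms] evals_main_check[OF assms]] by simp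
qed

lemma runs_program:
  assumes sM: "s \<le> M"
  shows "\<exists>\<tau>. runs program (init n s l) \<tau> \<and>
    outtape \<tau> = (if accepted then rat_digits l (p (digits s 0) 0) else [])"
proof -
  let ?\<rho> = "\<lambda>r. regs (init n s l) r"
  have init: "good (init n s l)" "agree 3 ?\<rho> (init n s l)" "qtape (init n s l) = []"
    "outtape (init n s l) = []"
    unfolding good_def agree_def init_def using M sM R by auto
  have "evals [] 3 ?\<rho> (Fold 3 (Assign 3 (Num 1)) (Reg 1) (Assign 5 (Times (Num 2) (Reg 3)))) (2 ^ s)"
  proof (rule evals_Fold[where A = "\<lambda>j. 2 ^ j" and ?d1.0 = 4 and ?d2.0 = 5])
    fix j assume "j < s"
    hence "(2::nat) ^ Suc j \<le> 2 ^ s" by (intro power_increasing) auto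
    thus "evals [] 5 (?\<rho>(3 := 2 ^ j, 4 := j)) (Assign 5 (Times (Num 2) (Reg 3))) (2 ^ Suc j)"
      using M(2) by (intro evals_Assign) auto
  qed (use M sM in \<open>auto simp: init_def intro!: evals_Assign\<close>)
  with init obtain \<sigma>1 where 1: "runs (Fold 3 (Assign 3 (Num 1)) (Reg 1) (Assign 5 (Times (Num 2) (Reg 3)))) (init n s l) \<sigma>1"
    "good \<sigma>1" "agree 4 (?\<rho>(3 := 2 ^ s)) \<sigma>1" "qtape \<sigma>1 = []" "outtape \<sigma>1 = []"
    unfolding evals_def by (metis eval_nat_numeral(2) semiring_norm(26,27))
  have base: "base (?\<rho>(3 := 2 ^ s))" by (simp add: base_def init_def)
  from evals_accept[OF base] 1 obtain \<sigma>2 where 2: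
    "runs (Seq last_check (If (Reg 4) main_check (Assign 4 (Num 0)))) \<sigma>1 \<sigma>2" "good \<sigma>2"
    "agree (Suc 4) (?\<rho>(3 := 2 ^ s, 4 := of_bool accepted)) \<sigma>2" "outtape \<sigma>2 = []"
    unfolding evals_def by metis
  have r4: "regs \<sigma>2 4 = of_bool accepted" using 2(3) by (simp add: agree_def)
  have "\<exists>\<tau>. runs (if val \<sigma>2 (Reg 4) \<noteq> 0 then Emit 4 (Plus (Num 1) (Times (Num 2) (Reg 2)))
      (ReadInput 5 (tape_pos (Num 1) (Reg 4))) else Skip) \<sigma>2 \<tau> \<and>
    outtape \<tau> = (if accepted then rat_digits l (p (digits s 0) 0) else [])"
  proof (cases accepted)
    case True
    let ?z = "rat_digits l (p (digits s 0) 0)"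
    have "\<exists>\<tau>. runs (Emit 4 (Plus (Num 1) (Times (Num 2) (Reg 2))) (ReadInput 5 (tape_pos (Num 1) (Reg 4)))) \<sigma>2 \<tau> \<and>
      outtape \<tau> = outtape \<sigma>2 @ ?z"
    proof (rule runs_Emit[where ?d1.0 = 5 and \<rho> = "?\<rho>(3 := 2 ^ s)"])
      fix j q assume "j < length ?z"
      thus "evals q 5 (?\<rho>(3 := 2 ^ s, 4 := j)) (ReadInput 5 (tape_pos (Num 1) (Reg 4))) (of_bool (?z ! j))"
        using input_tape_estimate[of 0 s 0 n j l \<epsilon> p] M
        by (intro evals_ReadInput) (auto simp: tape_pos_def init_def alg_env_def)
    next
      show "agree 4 (?\<rho>(3 := 2 ^ s)) \<sigma>2" using 2(3) by (simp add: agree_def)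
    qed (use 2(2) M in \<open>auto simp: init_def\<close>)
    thus ?thesis using True r4 2(4) by simp
  next
    case False
    thus ?thesis using r4 2(4) runs_Skip[OF 2(2)] by auto
  qed
  then obtain \<tau> where "runs (If (Reg 4) (Emit 4 (Plus (Num 1) (Times (Num 2) (Reg 2)))
      (ReadInput 5 (tape_pos (Num 1) (Reg 4)))) Skip) \<sigma>2 \<tau>"
    "outtape \<tau> = (if accepted then rat_digits l (p (digits s 0) 0) else [])"
    using runs_If by blast
  thus ?thesis unfolding program_def using 1(1) 2(1) runs_Seq by blast
qed

end

section \<open>The space bound\<close>

lemma floorlog_le:
  assumes "0 < m"
  shows "real (floorlog 2 m) \<le> log 2 (real m) + 1"
proof -
  have "0 \<le> log 2 (real m)" using assms by simp
  hence "real (nat \<lfloor>log 2 (real m)\<rfloor>) \<le> log 2 (real m)" by linarith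
  thus ?thesis using assms by (simp add: floorlog_def)
qed

text \<open>The register bound is polynomial in \<open>W = 2 ^ s * (n + 2)\<close>, whose logarithm
  is \<open>s\<close> plus that of \<open>n + 2\<close>. The exponent \<open>4 * k + 1\<close>
  covers both \<open>l ^ 4\<close> and, for \<open>k = 0\<close>, \<open>W\<close> itself.\<close>

lemma register_bound:
  assumes l: "l \<le> (2 ^ s * (n + 2)) ^ k"
  shows "real (floorlog 2 (n + 2 + (2 ^ s + 2) + (2 * l + 2) + 56 * l ^ 4 + s))
    \<le> real (4 * k + 8) * (real s + log 2 (real (n + 2)))"
proof -
  define W :: nat where "W = 2 ^ s * (n + 2)"
  define x where "x = real s + log 2 (real (n + 2))"
  have W: "n + 2 \<le> W" "2 ^ s * 2 \<le> W"
    using mult_le_mono1[of 1 "2 ^ s" "n + 2"] by (simp_all add: W_def)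
  have "s \<le> 2 ^ s" "1 \<le> (2::nat) ^ s" by (simp_all add: less_imp_le)
  have "1 \<le> W" using W by simp
  have pow: "W ^ j \<le> W ^ (4 * k + 1)" if "j \<le> 4 * k + 1" for j
    using \<open>1 \<le> W\<close> that by (rule power_increasing[rotated])
  have "l ^ 4 \<le> W ^ (4 * k)"
    using power_mono[OF l, of 4] by (simp add: W_def power_mult[symmetric] mult.commute)
  hence l4: "l ^ 4 \<le> W ^ (4 * k + 1)" using pow[of "4 * k"] by linarith
  \<comment> \<open>Of the factor 64, 56 + 2 is taken by the terms with \<open>l\<close>; the rest
    covers the other terms.\<close>
  have "n + 2 + (2 ^ s + 2) + (2 * l + 2) + 56 * l ^ 4 + s \<le> 64 * W ^ (4 * k + 1)"
  proof -
    have "W \<le> W ^ (4 * k + 1)" using pow[of 1] by simp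
    moreover have "l \<le> W ^ (4 * k + 1)" using l pow[of k] unfolding W_def[symmetric] by linarith
    ultimately show ?thesis using W l4 \<open>s \<le> 2 ^ s\<close> \<open>1 \<le> 2 ^ s\<close> by linarith
  qed
  hence "log 2 (real (n + 2 + (2 ^ s + 2) + (2 * l + 2) + 56 * l ^ 4 + s)) \<le> log 2 (real (64 * W ^ (4 * k + 1)))"
    by (intro log_mono; (simp only: of_nat_le_iff)?; simp)
  also have "\<dots> = 6 + real (4 * k + 1) * log 2 (real W)"
    using \<open>1 \<le> W\<close> log_pow_cancel[of 2 6] by (simp add: log_mult log_nat_power algebra_simps)
  also have "log 2 (real W) = x"
    unfolding W_def x_def of_nat_mult by (subst log_mult) simp_all
  finally have "real (floorlog 2 (n + 2 + (2 ^ s + 2) + (2 * l + 2) + 56 * l ^ 4 + s)) \<le> 7 + real (4 * k + 1) * x"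
    using floorlog_le[of "n + 2 + (2 ^ s + 2) + (2 * l + 2) + 56 * l ^ 4 + s"] by simp
  also have "1 \<le> log 2 (real (n + 2))" by simp
  hence "1 \<le> x" unfolding x_def by linarith
  \<comment> \<open>The constant is 6 from the factor 64 and 1 from rounding; it is absorbed because
    1 \<le> \<open>x\<close>.\<close>
  hence "7 + real (4 * k + 1) * x \<le> real (4 * k + 8) * x" by (simp add: algebra_simps)
  finally show ?thesis by (simp add: x_def)
qed

theorem theorem6p8:
  shows "\<exists>P :: com. \<forall>(c :: real) (k :: nat). \<exists>C :: real.
    \<forall>(n :: nat) (s :: nat) (w :: nat) (l :: nat) (\<epsilon> :: rat)
      (H :: bool list \<Rightarrow> bool list) (G :: com) (B :: obp) (p :: bool list \<Rightarrow> nat \<Rightarrow> rat).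
      hitting_set_generator (real_of_rat \<epsilon>) n s (obp_functions n (w ^ 2)) H \<longrightarrow>
      explicit_generator c G n s H \<longrightarrow>
      is_obp n w B \<longrightarrow>
      fits l \<epsilon> \<longrightarrow> (\<forall>x\<in>cube s. \<forall>i\<le>n. fits l (p x i)) \<longrightarrow>
      l \<le> (2 ^ s * (n + 2)) ^ k \<longrightarrow>
      (\<exists>\<tau> m res.
         exec (alg_env n s l \<epsilon> p B G) P (init n s l) \<tau> m \<and>
         real m \<le> C * (real s + log 2 (real (n + 2))) \<and>
         has_result l \<tau> res \<and>
         ((\<forall>x\<in>cube s.
             (\<forall>i<n. \<bar>accept_prob B (n - i) (walk B (start B) (take i (H x))) - real_of_rat (p x i)\<bar>
                       \<le> 2 * real_of_rat \<epsilon>) \<and>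
             p x n = of_bool (obp_eval B (H x)))
           \<longrightarrow> res \<noteq> None) \<and>
         (\<forall>\<delta>. res = Some \<delta> \<longrightarrow>
             \<bar>uniform_prob n (obp_eval B) - real_of_rat \<delta>\<bar> \<le> 6 * real_of_rat \<epsilon> * real n))"
proof (rule exI[of _ program], intro allI, rule_tac x = "41 * real (4 * k + 8) + \<bar>c\<bar>" in exI, intro allI impI)
  fix c :: real and k n s w l :: nat and \<epsilon> :: rat and H G B p
  assume hsg: "hitting_set_generator (real_of_rat \<epsilon>) n s (obp_functions n (w ^ 2)) H"
    and G: "explicit_generator c G n s H" and B: "is_obp n w B" and fits: "fits l \<epsilon>"
    and fits_p: "\<forall>x\<in>cube s. \<forall>i\<le>n. fits l (p x i)" and l: "l \<le> (2 ^ s * (n + 2)) ^ k"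
  define x where "x = real s + log 2 (real (n + 2))"
  have x: "0 \<le> x" by (simp add: x_def)
  define M where "M = n + 2 + (2 ^ s + 2) + (2 * l + 2) + 56 * l ^ 4 + s"
  define K where "K = nat \<lfloor>c * x\<rfloor>"
  \<comment> \<open>The absolute value covers a negative \<open>c\<close>, for which
    \<open>K\<close> is 0.\<close>
  have K: "real K \<le> \<bar>c\<bar> * x"
  proof -
    have "c * x \<le> \<bar>c\<bar> * x" "0 \<le> \<bar>c\<bar> * x" using x by (auto intro: mult_right_mono)
    thus ?thesis unfolding K_def by linarith
  qed
  interpret algorithm n s w l \<epsilon> H B p G M 40 K
  proof unfold_locales
    show "\<exists>m\<le>K. generator_runs G n s X (H (digits s X)) m" if "X < 2 ^ s" for X
    proof -
      from G that obtain m where m: "generator_runs G n s X (H (digits s X)) m" "real m \<le> c * x"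
        unfolding explicit_generator_def x_def by blast
      from m(2) have "m \<le> K" unfolding K_def by linarith
      with m(1) show ?thesis by blast
    qed
  qed (use hsg B fits fits_p in \<open>auto simp: M_def\<close>)
  define res where "res = (if accepted then Some (p (digits s 0) 0) else None)"
  have "s \<le> M" by (simp add: M_def)
  from runs_program[OF this] obtain \<tau> m where \<tau>: "exec (alg_env n s l \<epsilon> p B G) program (init n s l) \<tau> m" "m \<le> S"
    "outtape \<tau> = (if accepted then rat_digits l (p (digits s 0) 0) else [])"
    unfolding runs_def by blast
  \<comment> \<open>The factor 41 counts the 40 registers and the position counter of a
    call.\<close>
  have "real m \<le> 41 * real (floorlog 2 M) + real K"
    using \<tau>(2) by (simp add: S_def)
  also have "\<dots> \<le> 41 * (real (4 * k + 8) * x) + \<bar>c\<bar> * x"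
    using register_bound[OF l] K by (simp add: M_def x_def)
  also have "\<dots> = (41 * real (4 * k + 8) + \<bar>c\<bar>) * x" by (simp add: algebra_simps)
  finally have m: "real m \<le> (41 * real (4 * k + 8) + \<bar>c\<bar>) * (real s + log 2 (real (n + 2)))"
    by (simp add: x_def)
  show "\<exists>\<tau> m res. exec (alg_env n s l \<epsilon> p B G) program (init n s l) \<tau> m \<and>
      real m \<le> (41 * real (4 * k + 8) + \<bar>c\<bar>) * (real s + log 2 (real (n + 2))) \<and> has_result l \<tau> res \<and>
      ((\<forall>x\<in>cube s. (\<forall>i<n. \<bar>accept_prob B (n - i) (walk B (start B) (take i (H x))) - real_of_rat (p x i)\<bar>
                       \<le> 2 * real_of_rat \<epsilon>) \<and> p x n = of_bool (obp_eval B (H x))) \<longrightarrow> res \<noteq> None) \<and>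
      (\<forall>\<delta>. res = Some \<delta> \<longrightarrow> \<bar>uniform_prob n (obp_eval B) - real_of_rat \<delta>\<bar> \<le> 6 * real_of_rat \<epsilon> * real n)"
  proof (intro exI[of _ \<tau>] exI[of _ m] exI[of _ res] conjI impI allI)
    show "has_result l \<tau> res" using \<tau>(3) fits_p by (simp add: has_result_def res_def)
  next
    assume good: "\<forall>x\<in>cube s. (\<forall>i<n. \<bar>accept_prob B (n - i) (walk B (start B) (take i (H x))) - real_of_rat (p x i)\<bar>
      \<le> 2 * real_of_rat \<epsilon>) \<and> p x n = of_bool (obp_eval B (H x))"
    have accepted
      by (rule good_estimates_consistent) (use good in \<open>auto simp: reached_def seed_def\<close>)
    thus "res \<noteq> None" by (simp add: res_def)
  next
    fix \<delta> assume "res = Some \<delta>"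
    hence accepted "\<delta> = p (digits s 0) 0" by (auto simp: res_def split: if_splits)
    thus "\<bar>uniform_prob n (obp_eval B) - real_of_rat \<delta>\<bar> \<le> 6 * real_of_rat \<epsilon> * real n"
      using consistent_sound by simp
  qed (use \<tau>(1) m in auto)
qed

end
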